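(* Let $d\in\mathbb{N}$ and let $(T_i)_{i\in\mathbb{N}}\in GL_d(\mathbb{R})^{\mathbb{N}}$ be such that $\sup_{i\in\mathbb{N}}\|T_i\|<\tfrac12$ and the singular value function $\varphi^s$ is quasi-multiplicative for all $0\le s\le d$. Suppose there exists $0\le s_0\le d$ with $P(\varphi^{s_0})=0$, and let $\mu$ be the Gibbs measure for $\varphi^{s_0}$; suppose that $\Lambda_\mu(\varphi^{s_0})>-\infty$. For each $\mathbf a\in\mathbf A$ let $F'_{\mathbf a}\subset F_{\mathbf a}$ be a set with $\pi_{\mathbf a}\mu(F'_{\mathbf a})>0$. Then $$\dim_{\mathrm H}(F'_{\mathbf a})=\dim_{\mathrm H}(F_{\mathbf a})$$ for $\mathcal{L}_{\mathbf A}$-almost all $\mathbf a\in\mathbf A$.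
   Context: $\mathbb{N}=\{1,2,\ldots\}$; $\Sigma=\mathbb{N}^{\mathbb{N}}$ with the product topology of discrete $\mathbb{N}$; $\sigma$ is the left shift; $\Sigma_n=\mathbb{N}^n$, $\Sigma_*=\bigcup_{n\in\mathbb{N}}\Sigma_n$; $[\omega]=\{\omega\tau:\tau\in\Sigma\}$ for $\omega\in\Sigma_*$; $\omega|_n$ is the word of the first $n$ letters of $\omega$; juxtaposition denotes concatenation. A potential $\varphi\colon\Sigma_*\to(0,\infty)$ is sub-multiplicative if $\varphi(\omega\tau)\le\varphi(\omega)\varphi(\tau)$ for all $\omega,\tau\in\Sigma_*$; a sub-multiplicative potential is quasi-multiplicative if there exist $c\ge1$ and a finite set $\Gamma\subset\Sigma_*$ such that for all $\omega,\tau\in\Sigma_*$ there is $\kappa\in\Gamma$ with $\varphi(\omega)\varphi(\tau)\le c\,\varphi(\omega\kappa\tau)$. The pressure is $P(\varphi)=\lim_{n\to\infty}\frac1n\log\sum_{\omega\in\Sigma_n}\varphi(\omega)$. When $P(\varphi)$ is finite, a Gibbs measure for $\varphi$ is a $\sigma$-invariant Borel probability measure $\mu$ on $\Sigma$ for which there is $C\ge1$ with $C^{-1}\le\mu([\omega])/(\varphi(\omega)e^{-nP(\varphi)})\le C$ for all $\omega\in\Sigma_n$, $n\in\mathbb{N}$ (for a quasi-multiplicative $\varphi$ with $P(\varphi)<\infty$ it exists and is unique). The Lyapunov exponent is $\Lambda_\mu(\varphi)=\lim_{n\to\infty}\frac1n\sum_{\omega\in\Sigma_n}\mu([\omega])\log\varphi(\omega)$.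 For $T\in GL_d(\mathbb{R})$ let $\gamma_1(T)\ge\cdots\ge\gamma_d(T)>0$ be its singular values. For $0<s\le d$ write $s=m+\delta$ with $m\in\mathbb{Z}$, $0<\delta\le1$, and put $\varphi^s(T)=\gamma_1(T)\cdots\gamma_m(T)\gamma_{m+1}(T)^\delta$; put $\varphi^0(T)=1$. For $\omega=\omega_1\cdots\omega_n\in\Sigma_n$ let $T_\omega=T_{\omega_1}\cdots T_{\omega_n}$ and $\varphi^s(\omega)=\varphi^s(T_\omega)$ (the singular value function). $\mathbf A=([0,1]^d)^{\mathbb{N}}$ carries the product probability measure $\mathcal{L}_{\mathbf A}=(\mathcal{L}^d|_{[0,1]^d})^{\mathbb{N}}$, $\mathcal{L}^d$ being Lebesgue measure. For $\mathbf a=(a_i)_{i\in\mathbb{N}}\in\mathbf A$, $\pi_{\mathbf a}\colon\Sigma\to\mathbb{R}^d$ is $\pi_{\mathbf a}(\omega)=\sum_{j=1}^\infty T_{\omega|_{j-1}}a_{\omega_j}$ (with $T_{\omega|_0}$ the identity), $F_{\mathbf a}=\pi_{\mathbf a}(\Sigma)$, and $\pi_{\mathbf a}\mu$ is the pushforward of $\mu$ under $\pi_{\mathbf a}$. *)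

theory Defs
  imports "HOL-Probability.Probability"
begin

section \<open>The symbolic space\<close>

text \<open>
  Letters are indexed by \<^typ>\<open>nat\<close> starting from \<open>0\<close>; the symbolic space \<open>\<Sigma>\<close> is the type
  \<^typ>\<open>nat \<Rightarrow> nat\<close>, whose topology is the product of the discrete topologies.  The set
  \<open>\<Sigma>\<^sub>*\<close> of finite words consists of the \<^emph>\<open>nonempty\<close> lists, so a potential is a function on lists
  whose value at the empty list is never used.
\<close>

definition words :: "nat \<Rightarrow> nat list set" where
  "words n = {w. length w = n}"

definition conc :: "nat list \<Rightarrow> (nat \<Rightarrow> nat) \<Rightarrow> (nat \<Rightarrow> nat)" where
  "conc w x = (\<lambda>i. if i < length w then w ! i else x (i - length w))"

definition cylinder :: "nat list \<Rightarrow> (nat \<Rightarrow> nat) set" where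
  "cylinder w = range (conc w)"

definition shift :: "(nat \<Rightarrow> nat) \<Rightarrow> (nat \<Rightarrow> nat)" where
  "shift x = (\<lambda>i. x (Suc i))"

definition prefix_word :: "(nat \<Rightarrow> nat) \<Rightarrow> nat \<Rightarrow> nat list" where
  "prefix_word x n = map x [0..<n]"


section \<open>Potentials\<close>

definition submultiplicative :: "(nat list \<Rightarrow> real) \<Rightarrow> bool" where
  "submultiplicative \<phi> \<longleftrightarrow>
     (\<forall>w. w \<noteq> [] \<longrightarrow> \<phi> w > 0) \<and>
     (\<forall>w v. w \<noteq> [] \<longrightarrow> v \<noteq> [] \<longrightarrow> \<phi> (w @ v) \<le> \<phi> w * \<phi> v)"

definition quasi_multiplicative :: "(nat list \<Rightarrow> real) \<Rightarrow> bool" where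
  "quasi_multiplicative \<phi> \<longleftrightarrow>
     submultiplicative \<phi> \<and>
     (\<exists>c\<ge>1. \<exists>\<Gamma>. finite \<Gamma> \<and> [] \<notin> \<Gamma> \<and>
        (\<forall>w v. w \<noteq> [] \<longrightarrow> v \<noteq> [] \<longrightarrow> (\<exists>k\<in>\<Gamma>. \<phi> w * \<phi> v \<le> c * \<phi> (w @ k @ v))))"

text \<open>The logarithm as a map from \<open>[0,\<infinity>]\<close> to \<open>[-\<infinity>,\<infinity>]\<close>.\<close>

definition eln :: "ennreal \<Rightarrow> ereal" where
  "eln x = (if x = 0 then -\<infinity> else if x = \<infinity> then \<infinity> else ereal (ln (enn2real x)))"

text \<open>The sums over \<open>\<Sigma>\<^sub>n\<close> may be infinite, so the limit is taken in the extended reals.\<close>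

definition pressure :: "(nat list \<Rightarrow> real) \<Rightarrow> ereal" where
  "pressure \<phi> = lim (\<lambda>n. eln (\<Sum>\<^sub>\<infinity>w\<in>words n. ennreal (\<phi> w)) / ereal (real n))"

definition gibbs_measure :: "(nat list \<Rightarrow> real) \<Rightarrow> (nat \<Rightarrow> nat) measure \<Rightarrow> bool" where
  "gibbs_measure \<phi> \<mu> \<longleftrightarrow>
     \<bar>pressure \<phi>\<bar> \<noteq> \<infinity> \<and>
     sets \<mu> = sets borel \<and> prob_space \<mu> \<and> distr \<mu> borel shift = \<mu> \<and>
     (\<exists>C\<ge>1. \<forall>n\<ge>1. \<forall>w\<in>words n.
        1 / C \<le> measure \<mu> (cylinder w) / (\<phi> w * exp (- real n * real_of_ereal (pressure \<phi>))) \<and>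
        measure \<mu> (cylinder w) / (\<phi> w * exp (- real n * real_of_ereal (pressure \<phi>))) \<le> C)"

text \<open>
  For a Gibbs measure the positive parts \<open>\<mu>([w]) max(log \<phi>(w), 0)\<close> have a finite sum over \<open>\<Sigma>\<^sub>n\<close>, so
  the unordered sum below converges in \<open>[-\<infinity>,\<infinity>)\<close>.
\<close>

definition lyapunov_exponent :: "(nat \<Rightarrow> nat) measure \<Rightarrow> (nat list \<Rightarrow> real) \<Rightarrow> ereal" where
  "lyapunov_exponent \<mu> \<phi> =
     lim (\<lambda>n. (\<Sum>\<^sub>\<infinity>w\<in>words n. ereal (measure \<mu> (cylinder w) * ln (\<phi> w))) / ereal (real n))"


section \<open>Singular values and the singular value function\<close>

text \<open>
  The singular values of \<open>A\<close> are the square roots of the eigenvalues of \<open>A\<^sup>T A\<close>, listed in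
  decreasing order and repeated according to multiplicity.  As \<open>A\<^sup>T A\<close> is symmetric, the
  multiplicity of an eigenvalue is the dimension of its eigenspace.
\<close>

definition eigenspace :: "real^'d^'d \<Rightarrow> real \<Rightarrow> (real^'d) set" where
  "eigenspace A l = {v. A *v v = l *\<^sub>R v}"

definition singular_values :: "real^'d^'d \<Rightarrow> real list" where
  "singular_values A =
     rev (sorted_list_of_multiset
       (\<Sum>l | eigenspace (transpose A ** A) l \<noteq> {0}.
          replicate_mset (dim (eigenspace (transpose A ** A) l)) (sqrt l)))"

definition singular_value :: "nat \<Rightarrow> real^'d^'d \<Rightarrow> real" where
  "singular_value k A = singular_values A ! (k - 1)"

text \<open>For \<open>s > 0\<close>, the integer \<open>m = \<lceil>s\<rceil> - 1\<close> is the one with \<open>0 < s - m \<le> 1\<close>.\<close>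

definition singular_value_function :: "real \<Rightarrow> real^'d^'d \<Rightarrow> real" where
  "singular_value_function s A =
     (if s = 0 then 1
      else let m = nat (\<lceil>s\<rceil> - 1) in
        (\<Prod>k=1..m. singular_value k A) * singular_value (m + 1) A powr (s - real m))"

definition word_matrix :: "(nat \<Rightarrow> real^'d^'d) \<Rightarrow> nat list \<Rightarrow> real^'d^'d" where
  "word_matrix T w = foldr (\<lambda>i B. T i ** B) w (mat 1)"

definition sv_potential :: "(nat \<Rightarrow> real^'d^'d) \<Rightarrow> real \<Rightarrow> nat list \<Rightarrow> real" where
  "sv_potential T s w = singular_value_function s (word_matrix T w)"


section \<open>Self-affine sets\<close>

definition translation_measure :: "(nat \<Rightarrow> real^'d) measure" where
  "translation_measure = (\<Pi>\<^sub>M i\<in>UNIV. restrict_space lborel (cbox 0 1))"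

definition coding_map :: "(nat \<Rightarrow> real^'d^'d) \<Rightarrow> (nat \<Rightarrow> real^'d) \<Rightarrow> (nat \<Rightarrow> nat) \<Rightarrow> real^'d" where
  "coding_map T a x = (\<Sum>j. word_matrix T (prefix_word x j) *v a (x j))"

definition self_affine_set :: "(nat \<Rightarrow> real^'d^'d) \<Rightarrow> (nat \<Rightarrow> real^'d) \<Rightarrow> (real^'d) set" where
  "self_affine_set T a = range (coding_map T a)"


section \<open>Hausdorff dimension\<close>

text \<open>\<open>diam(U)\<^sup>s\<close>, with the conventions \<open>diam(\<emptyset>)\<^sup>s = 0\<close> and \<open>0\<^sup>0 = 1\<close> (whereas \<open>0 powr 0 = 0\<close>).\<close>

definition diam_pow :: "real \<Rightarrow> 'a::metric_space set \<Rightarrow> ennreal" where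
  "diam_pow s U = (if U = {} then 0 else if s = 0 then 1 else ennreal (diameter U powr s))"

text \<open>Boundedness is required because \<^const>\<open>diameter\<close> is meaningless on unbounded sets.\<close>

definition hausdorff_premeasure :: "real \<Rightarrow> real \<Rightarrow> 'a::metric_space set \<Rightarrow> ennreal" where
  "hausdorff_premeasure s \<delta> E =
     (INF U\<in>{U :: nat \<Rightarrow> 'a set. E \<subseteq> (\<Union>i. U i) \<and> (\<forall>i. bounded (U i) \<and> diameter (U i) \<le> \<delta>)}.
        \<Sum>i. diam_pow s (U i))"

definition hausdorff_measure :: "real \<Rightarrow> 'a::metric_space set \<Rightarrow> ennreal" where
  "hausdorff_measure s E = (SUP \<delta>\<in>{0<..}. hausdorff_premeasure s \<delta> E)"

definition hausdorff_dim :: "'a::metric_space set \<Rightarrow> ennreal" where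
  "hausdorff_dim E = Inf {ennreal s |s. 0 \<le> s \<and> hausdorff_measure s E = 0}"

end

theory Submission
  imports Defs
begin

text \<open>
  Both dimensions are almost surely equal to \<open>s0\<close>.  As the pressure at \<open>s0\<close> is
  \<open>0\<close>, the Gibbs property makes \<open>\<mu>([w])\<close> and \<open>\<phi>(w)\<close>, the
  potential at \<open>s0\<close>, comparable up to a constant, for all words \<open>w\<close>.  Fix
  \<open>\<theta> < 1/2\<close> that bounds the norms of all \<open>T i\<close>, and write
  \<open>T w\<close> for the product along \<open>w\<close> and \<open>\<pi> a\<close> for the coding map.

  \<^emph>\<open>Upper bound, for every \<open>a\<close>.\<close> Let \<open>m\<close> be the integer with
  \<open>0 < s0 - m \<le> 1\<close>, and \<open>m = 0\<close> if \<open>s0 = 0\<close>.  An ellipsoid with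
  the singular values of \<open>T w\<close> as semi-axes is covered by about
  \<open>\<phi>(w) / h^s0\<close> balls of radius comparable to \<open>h\<close>, if \<open>h\<close> is
  the singular value number \<open>m + 1\<close> (\<open>ball_image_cover\<close>).  So for
  \<open>t > s0\<close> the level \<open>n\<close> cylinders give a cover with sum of the
  \<open>t\<close>-th powers of diameters at most a constant times the sum of
  \<open>\<phi>(w) \<theta>^(n (t - s0))\<close>; the sum of \<open>\<phi>(w)\<close> over words of length
  \<open>n\<close> is bounded because that of \<open>\<mu>([w])\<close> is \<open>1\<close>
  (\<open>hausdorff_dim_self_affine_le\<close>).

  \<^emph>\<open>Lower bound, for almost every \<open>a\<close>.\<close> Let \<open>s0 > 0\<close>, as
  otherwise the bound is trivial.  If the Riesz potential of exponent \<open>t\<close> of a measure is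
  finite almost everywhere, then every set of positive outer measure has dimension at least
  \<open>t\<close> (\<open>hausdorff_dim_ge_of_potential\<close>).  Apply this to the image of
  \<open>\<mu>\<close> with \<open>t = \<rho> s0\<close> and \<open>\<rho> < 1\<close>.  It suffices that
  the potential at \<open>\<pi> a x\<close> has a finite average over \<open>a\<close>, uniformly in
  \<open>x\<close>.  If \<open>x\<close> and \<open>y\<close> have the longest common prefix
  \<open>w\<close>, then \<open>\<pi> a x - \<pi> a y\<close> is the image under \<open>T w\<close> of a
  vector which depends on one of the translations by an affine map whose linear part shrinks no vector by
  more than a fixed factor (\<open>transversality\<close>); here \<open>\<theta> < 1/2\<close> is
  essential.  Integrating over this translation reduces the average of \<open>\<bar>\<pi> a x - \<pi> a
  y\<bar>^(- \<rho> s0)\<close> to an integral of \<open>\<bar>T w u\<bar>^(- \<rho> s0)\<close> over a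
  bounded set of \<open>u\<close>.  In coordinates \<open>u k\<close> along the singular directions, with
  \<open>e k\<close> the exponents in which the singular values \<open>\<gamma> k\<close> enter
  \<open>\<phi>\<close>, the integrand is at most the product of
  \<open>(\<gamma> k \<bar>u k\<bar>)^(- \<rho> e k)\<close>.  The exponents \<open>e k\<close> may be
  \<open>1\<close>, but \<open>\<rho> e k < 1\<close>, so every factor is integrable, and the integral is
  at most a constant times \<open>\<phi>(w)^(- \<rho>)\<close>
  (\<open>nn_integral_riesz_kernel_affine_le\<close>).  Summing over the prefixes \<open>w\<close> of
  \<open>x\<close> with weights \<open>\<mu>([w])\<close>, each at most a constant times
  \<open>\<phi>(w)\<close>, bounds the averaged potential by a constant times the sum of
  \<open>\<phi>(w)^(1 - \<rho>)\<close>, dominated by a geometric series since \<open>\<phi>(w)\<close> is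
  at most \<open>\<theta>^(n s0)\<close> for words of length \<open>n\<close>
  (\<open>AE_potential_finite\<close>).
\<close>


section \<open>Singular values as an orthonormal decomposition\<close>

text \<open>
  A maximiser of the quadratic form \<open>x \<bullet> f x\<close> on the unit sphere of \<open>S\<close> is an eigenvector.
\<close>

lemma selfadjoint_eigenvector_exists:
  fixes f :: "'a::euclidean_space \<Rightarrow> 'a"
  assumes "linear f" and sym: "\<And>x y. f x \<bullet> y = x \<bullet> f y"
    and S: "subspace S" and inv: "f ` S \<subseteq> S" and nz: "S \<noteq> {0}"
  obtains u l where "u \<in> S" "norm u = 1" "f u = l *\<^sub>R u"
proof -
  interpret f: linear f by fact
  define K where "K = {x\<in>S. norm x = 1}"
  have "K = S \<inter> sphere 0 1"
    by (auto simp: K_def)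
  then have "compact K"
    using closed_subspace[OF S] by (simp add: closed_Int_compact)
  moreover have "K \<noteq> {}"
  proof -
    obtain x where "x \<in> S" "x \<noteq> 0"
      using nz subspace_0[OF S] by auto
    then have "(1 / norm x) *\<^sub>R x \<in> K"
      using subspace_scale[OF S] by (simp add: K_def)
    then show ?thesis by auto
  qed
  moreover have "continuous_on K (\<lambda>x. x \<bullet> f x)"
    by (intro continuous_intros linear_continuous_on linear_conv_bounded_linear[THEN iffD1] \<open>linear f\<close>)
  ultimately obtain u where u: "u \<in> K" and max: "\<And>y. y \<in> K \<Longrightarrow> y \<bullet> f y \<le> u \<bullet> f u"
    using continuous_attains_sup[of K "\<lambda>x. x \<bullet> f x"] by auto
  define l where "l = u \<bullet> f u"
  have uS: "u \<in> S" and u1: "norm u = 1" and uu: "u \<bullet> u = 1"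
    using u by (auto simp: K_def norm_eq_1)
  have max': "x \<bullet> f x \<le> l * (norm x)\<^sup>2" if "x \<in> S" for x
  proof (cases "x = 0")
    case False
    have "(1 / norm x) *\<^sub>R x \<in> K"
      using subspace_scale[OF S that] False by (simp add: K_def)
    from max[OF this] have "(1 / norm x) * (1 / norm x) * (x \<bullet> f x) \<le> l"
      by (simp add: f.scaleR l_def)
    then show ?thesis
      using False by (simp add: field_simps power2_eq_square)
  qed (simp add: f.zero)
  \<comment> \<open>First-order condition at the maximum: no component of \<open>f u\<close> orthogonal to \<open>u\<close>.\<close>
  have orth: "f u \<bullet> v = 0" if v: "v \<in> S" "v \<bullet> u = 0" for v
  proof (rule ccontr)
    define a where "a = f u \<bullet> v"
    define c where "c = l * (norm v)\<^sup>2 - v \<bullet> f v"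
    assume "f u \<bullet> v \<noteq> 0"
    then have a: "a \<noteq> 0" by (simp add: a_def)
    \<comment> \<open>Moving from \<open>u\<close> by \<open>t v\<close> gains \<open>2 t a\<close> at first order and loses at most \<open>t\<^sup>2 \<bar>c\<bar>\<close>;
      this \<open>t\<close> is small enough for the gain to win.\<close>
    define t where "t = a / (\<bar>c\<bar> + 1)"
    have "(u + t *\<^sub>R v) \<bullet> f (u + t *\<^sub>R v) \<le> l * (norm (u + t *\<^sub>R v))\<^sup>2"
      by (intro max' subspace_add[OF S] subspace_scale[OF S] uS v)
    moreover have "(u + t *\<^sub>R v) \<bullet> f (u + t *\<^sub>R v) = l + 2 * t * a + t\<^sup>2 * (v \<bullet> f v)"
      using sym[of u v]
      by (simp add: f.add f.scaleR inner_add_left inner_add_right l_def a_def power2_eq_square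
          inner_commute algebra_simps)
    moreover have "(norm (u + t *\<^sub>R v))\<^sup>2 = 1 + t\<^sup>2 * (norm v)\<^sup>2"
      using v uu by (simp only: power2_norm_eq_inner)
        (simp add: inner_add_left inner_add_right inner_commute power2_eq_square)
    ultimately have "2 * t * a \<le> t\<^sup>2 * c"
      by (simp add: c_def algebra_simps)
    then have "2 * t * a * ((\<bar>c\<bar> + 1) * (\<bar>c\<bar> + 1)) \<le> t\<^sup>2 * c * ((\<bar>c\<bar> + 1) * (\<bar>c\<bar> + 1))"
      by (intro mult_right_mono) auto
    moreover have t: "t * (\<bar>c\<bar> + 1) = a"
      by (simp add: t_def)
    have "2 * t * a * ((\<bar>c\<bar> + 1) * (\<bar>c\<bar> + 1)) = 2 * (t * (\<bar>c\<bar> + 1)) * a * (\<bar>c\<bar> + 1)"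
      "t\<^sup>2 * c * ((\<bar>c\<bar> + 1) * (\<bar>c\<bar> + 1)) = (t * (\<bar>c\<bar> + 1)) * (t * (\<bar>c\<bar> + 1)) * c"
      by (simp_all only: power2_eq_square mult_ac)
    ultimately have "2 * a * a * (\<bar>c\<bar> + 1) \<le> a * a * c"
      unfolding t by linarith
    then have "(a * a) * (2 * \<bar>c\<bar> + 2 - c) \<le> 0"
      by (simp add: algebra_simps)
    moreover have "a * a > 0" "2 * \<bar>c\<bar> + 2 - c > 0"
      using a by (auto simp flip: power2_eq_square)
    then have "(a * a) * (2 * \<bar>c\<bar> + 2 - c) > 0"
      by (rule mult_pos_pos)
    ultimately show False by simp
  qed
  \<comment> \<open>The residual \<open>v\<close> lies in \<open>S\<close> and is orthogonal to \<open>u\<close>, hence also to \<open>f u\<close>, hence to itself.\<close>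
  define v where "v = f u - l *\<^sub>R u"
  have "v \<in> S"
    unfolding v_def using inv uS by (intro subspace_diff[OF S] subspace_scale[OF S]) auto
  moreover have vu: "v \<bullet> u = 0"
    by (simp add: v_def inner_diff_left l_def uu) (simp add: inner_commute)
  ultimately have "f u \<bullet> v = 0" by (rule orth)
  then have "v \<bullet> v = 0"
    using vu by (simp add: v_def inner_diff_left inner_commute)
  then have "f u = l *\<^sub>R u"
    by (simp add: v_def)
  with uS u1 show ?thesis by (rule that)
qed

text \<open>
  Induction on the dimension: split off one eigenvector; its orthogonal complement in \<open>S\<close> is again
  invariant because \<open>f\<close> is self-adjoint.
\<close>

lemma selfadjoint_orthonormal_eigenbasis:
  fixes f :: "'a::euclidean_space \<Rightarrow> 'a"
  assumes lin: "linear f" and sym: "\<And>x y. f x \<bullet> y = x \<bullet> f y"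
    and S: "subspace S" and inv: "f ` S \<subseteq> S"
  shows "\<exists>B. finite B \<and> B \<subseteq> S \<and> S \<subseteq> span B \<and> pairwise orthogonal B \<and>
             (\<forall>b\<in>B. norm b = 1 \<and> (\<exists>l. f b = l *\<^sub>R b))"
  using S inv
proof (induction "dim S" arbitrary: S rule: less_induct)
  case less
  show ?case
  proof (cases "S = {0}")
    case True
    then show ?thesis by (intro exI[of _ "{}"]) auto
  next
    case False
    obtain u l where u: "u \<in> S" "norm u = 1" "f u = l *\<^sub>R u"
      using selfadjoint_eigenvector_exists[OF lin sym less.prems False] by auto
    define S' where "S' = {x\<in>S. x \<bullet> u = 0}"
    have S'_eq: "S' = S \<inter> {x. u \<bullet> x = 0}"
      by (auto simp: S'_def inner_commute)
    have S': "subspace S'"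
      unfolding S'_eq by (intro subspace_inter less.prems subspace_hyperplane)
    have inv': "f ` S' \<subseteq> S'"
      using less.prems(2) by (auto simp: S'_def sym u)
    have "u \<notin> S'"
      using u by (auto simp: S'_def)
    moreover have "S' \<subseteq> S" by (auto simp: S'_def)
    ultimately have "S' \<subset> S" using u by auto
    then have "dim S' < dim S"
      using S' less.prems(1) by (intro dim_psubset) (simp add: span_eq_iff[THEN iffD2])
    from less.hyps[OF this S' inv'] obtain B where B: "finite B" "B \<subseteq> S'" "S' \<subseteq> span B"
      "pairwise orthogonal B" "\<And>b. b \<in> B \<Longrightarrow> norm b = 1 \<and> (\<exists>l. f b = l *\<^sub>R b)" by blast
    have "S \<subseteq> span (insert u B)"
    proof
      fix x assume x: "x \<in> S"
      have "x - (x \<bullet> u) *\<^sub>R u \<in> S'"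
        using x u less.prems(1)
        by (auto simp: S'_def inner_diff_left subspace_diff subspace_scale norm_eq_1)
      then have "x - (x \<bullet> u) *\<^sub>R u \<in> span (insert u B)"
        using B(3) span_mono[of B "insert u B"] by auto
      moreover have "(x \<bullet> u) *\<^sub>R u \<in> span (insert u B)"
        by (simp add: span_base span_scale)
      ultimately have "(x - (x \<bullet> u) *\<^sub>R u) + (x \<bullet> u) *\<^sub>R u \<in> span (insert u B)"
        by (rule span_add)
      then show "x \<in> span (insert u B)" by simp
    qed
    moreover have "pairwise orthogonal (insert u B)"
      using B(2,4) by (auto simp: pairwise_insert S'_def orthogonal_def inner_commute)
    ultimately show ?thesis
      using B u \<open>S' \<subseteq> S\<close> by (intro exI[of _ "insert u B"]) auto
  qed
qed

lemma orthonormal_expansion: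
  assumes "finite B" "span B = UNIV" "pairwise orthogonal B" "\<And>b. b \<in> B \<Longrightarrow> norm b = 1"
  shows "(x :: 'a::euclidean_space) = (\<Sum>b\<in>B. (x \<bullet> b) *\<^sub>R b)"
proof -
  have *: "(\<Sum>b\<in>B. (x \<bullet> b) *\<^sub>R b) \<bullet> c = x \<bullet> c" if "c \<in> B" for c
  proof -
    have "(\<Sum>b\<in>B. (x \<bullet> b) *\<^sub>R b) \<bullet> c = (\<Sum>b\<in>B. if b = c then x \<bullet> c else 0)"
      unfolding inner_sum_left
      using assms(3,4) that by (intro sum.cong) (auto simp: pairwise_def orthogonal_def norm_eq_1)
    then show ?thesis using assms(1) that by simp
  qed
  define y where "y = x - (\<Sum>b\<in>B. (x \<bullet> b) *\<^sub>R b)"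
  have "orthogonal y c" if "c \<in> B" for c
    using *[OF that] by (simp add: y_def orthogonal_def inner_diff_left)
  then have "orthogonal y y"
    using orthogonal_to_span[of y B y] assms(2) by auto
  then show ?thesis by (simp add: y_def orthogonal_def)
qed

text \<open>
  A vector of the eigenspace of \<open>l\<close> is orthogonal to the eigenvectors of all other eigenvalues, so only
  basis vectors with eigenvalue \<open>l\<close> occur in its expansion.
\<close>

lemma dim_eigenspace_eq_card:
  fixes A :: "real^'d^'d"
  assumes sym: "\<And>x y. (A *v x) \<bullet> y = x \<bullet> (A *v y)"
    and B: "finite B" "span B = UNIV" "pairwise orthogonal B" "\<And>b. b \<in> B \<Longrightarrow> norm b = 1"
    and lam: "\<And>b. b \<in> B \<Longrightarrow> A *v b = lam b *\<^sub>R b"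
  shows "dim (eigenspace A l) = card {b\<in>B. lam b = l}"
proof -
  have "eigenspace A l = span {b\<in>B. lam b = l}"
  proof
    show "span {b\<in>B. lam b = l} \<subseteq> eigenspace A l"
    proof (rule span_minimal)
      show "subspace (eigenspace A l)"
        unfolding eigenspace_def
        by (auto simp: subspace_def matrix_vector_right_distrib matrix_vector_mult_scaleR scaleR_add_right)
    qed (auto simp: eigenspace_def lam)
    show "eigenspace A l \<subseteq> span {b\<in>B. lam b = l}"
    proof
      fix x assume x: "x \<in> eigenspace A l"
      have 0: "x \<bullet> b = 0" if "b \<in> B" "lam b \<noteq> l" for b
      proof -
        have "l * (x \<bullet> b) = lam b * (x \<bullet> b)"
          using sym[of x b] x lam[OF that(1)] by (simp add: eigenspace_def)
        with that show ?thesis by simp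
      qed
      have "x = (\<Sum>b\<in>B. (x \<bullet> b) *\<^sub>R b)"
        using B by (rule orthonormal_expansion)
      also have "\<dots> = (\<Sum>b\<in>{b\<in>B. lam b = l}. (x \<bullet> b) *\<^sub>R b)"
        using B(1) 0 by (intro sum.mono_neutral_right) auto
      also have "\<dots> \<in> span {b\<in>B. lam b = l}"
        by (intro span_sum span_scale span_base)
      finally show "x \<in> span {b\<in>B. lam b = l}" .
    qed
  qed
  moreover have "independent {b\<in>B. lam b = l}"
    by (rule pairwise_orthogonal_independent)
      (use B(3,4) in \<open>auto simp: pairwise_def\<close>, fastforce)
  ultimately show ?thesis
    by (simp add: dim_eq_card_independent)
qed

text \<open>
  This matches the singular values, which are defined by listing each eigenvalue with its multiplicity,
  with a list indexed by an eigenbasis.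
\<close>

lemma sum_replicate_mset_fibres:
  assumes "finite B"
  shows "(\<Sum>l\<in>f ` B. replicate_mset (card {b\<in>B. f b = l}) (g l)) = image_mset (\<lambda>b. g (f b)) (mset_set B)"
proof -
  have "image_mset (\<lambda>b. g (f b)) (mset_set B) = (\<Sum>b\<in>B. {# g (f b) #})"
    using assms by (induction B rule: finite_induct) auto
  also have "\<dots> = (\<Sum>l\<in>f ` B. \<Sum>b\<in>{b\<in>B. f b = l}. {# g (f b) #})"
    using assms by (rule sum.image_gen)
  also have "\<dots> = (\<Sum>l\<in>f ` B. replicate_mset (card {b\<in>B. f b = l}) (g l))"
  proof (rule sum.cong[OF refl])
    fix l
    have "(\<Sum>b\<in>C. {# g (f b) #}) = replicate_mset (card C) (g l)"
      if "finite C" "\<forall>b\<in>C. f b = l" for C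
      using that by (induction C rule: finite_induct) auto
    then show "(\<Sum>b\<in>{b\<in>B. f b = l}. {# g (f b) #}) = replicate_mset (card {b\<in>B. f b = l}) (g l)"
      using assms by simp
  qed
  finally show ?thesis by simp
qed

text \<open>
  The bijection \<open>idx\<close> numbers the coordinates so that \<open>v k\<close> belongs to the singular value with the
  zero-based number \<open>idx k\<close>.  Orthogonality of the images \<open>A *v v k\<close> is encoded in the formula for
  \<open>norm (A *v x)\<close>, the only form in which it is used.
\<close>

definition right_singular_basis :: "real^'d^'d \<Rightarrow> ('d \<Rightarrow> nat) \<Rightarrow> ('d \<Rightarrow> real^'d) \<Rightarrow> bool" where
  "right_singular_basis A idx v \<longleftrightarrow>
     bij_betw idx UNIV {..<CARD('d)} \<and>
     (\<forall>j k. v j \<bullet> v k = (if j = k then 1 else 0)) \<and>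
     (\<forall>x. (norm (A *v x))\<^sup>2 = (\<Sum>k\<in>UNIV. (singular_value (Suc (idx k)) A * (x \<bullet> v k))\<^sup>2)) \<and>
     (\<forall>i j. i \<le> j \<longrightarrow> j < CARD('d) \<longrightarrow> singular_value (Suc j) A \<le> singular_value (Suc i) A) \<and>
     (\<forall>i<CARD('d). 0 \<le> singular_value (Suc i) A)"

text \<open>
  Take an orthonormal eigenbasis of \<open>A\<^sup>T A\<close>; the eigenvalue of \<open>b\<close> is the square of \<open>norm (A *v b)\<close>.
\<close>

lemma singular_value_decomposition:
  fixes A :: "real^'d^'d"
  obtains idx v where "right_singular_basis A idx v"
proof -
  define M where "M = transpose A ** A"
  have M: "(M *v x) \<bullet> y = (A *v x) \<bullet> (A *v y)" for x y
    by (simp add: M_def matrix_vector_mul_assoc[symmetric] dot_lmul_matrix[symmetric]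
        transpose_matrix_vector inner_commute)
  have sym: "(M *v x) \<bullet> y = x \<bullet> (M *v y)" for x y
    using M[of x y] M[of y x] by (simp add: inner_commute)
  obtain B where B: "finite B" "UNIV \<subseteq> span B" "pairwise orthogonal B"
    "\<And>b. b \<in> B \<Longrightarrow> norm b = 1" "\<And>b. b \<in> B \<Longrightarrow> (\<exists>l. M *v b = l *\<^sub>R b)"
    using selfadjoint_orthonormal_eigenbasis[OF matrix_vector_mul_linear[of M] sym subspace_UNIV]
    by auto
  have spanB: "span B = UNIV" using B(2) by auto
  define lam where "lam b = (norm (A *v b))\<^sup>2" for b
  have lam: "M *v b = lam b *\<^sub>R b" if b: "b \<in> B" for b
  proof -
    obtain l where l: "M *v b = l *\<^sub>R b" using B(5)[OF b] by auto
    have "l = (M *v b) \<bullet> b" using B(4)[OF b] by (simp add: l norm_eq_1)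
    also have "\<dots> = lam b" by (simp add: M lam_def power2_norm_eq_inner)
    finally show ?thesis using l by simp
  qed
  have dim: "dim (eigenspace M l) = card {b\<in>B. lam b = l}" for l
    using sym B(1) spanB B(3,4) lam by (rule dim_eigenspace_eq_card)
  have "0 \<notin> B" using B(4)[of 0] by auto
  then have "independent B"
    using B(3) by (simp add: pairwise_orthogonal_independent)
  then have cardB: "card B = CARD('d)"
    using dim_eq_card_independent[of B] dim_span[of B] spanB by simp
  have zero: "0 \<in> eigenspace M l" for l
    by (simp add: eigenspace_def)
  have "eigenspace M l \<noteq> {0} \<longleftrightarrow> l \<in> lam ` B" for l
  proof -
    have "eigenspace M l \<noteq> {0} \<longleftrightarrow> dim (eigenspace M l) \<noteq> 0"
      using zero[of l] by auto
    also have "\<dots> \<longleftrightarrow> l \<in> lam ` B"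
      using B(1) by (auto simp: dim card_eq_0_iff)
    finally show ?thesis .
  qed
  then have "{l. eigenspace M l \<noteq> {0}} = lam ` B" by blast
  then have sv: "singular_values A = rev (sorted_list_of_multiset (image_mset (\<lambda>b. sqrt (lam b)) (mset_set B)))"
    unfolding singular_values_def M_def[symmetric]
    using sum_replicate_mset_fibres[OF B(1), of lam sqrt] by (simp add: dim)
  define g where "g b = sqrt (lam b)" for b
  obtain bs0 where bs0: "set bs0 = B" "distinct bs0"
    using finite_distinct_list[OF B(1)] by auto
  define bs where "bs = rev (sort_key g bs0)"
  have bs: "set bs = B" "distinct bs" "length bs = CARD('d)"
    using bs0 cardB distinct_card[of bs0] by (auto simp: bs_def)
  have "sorted_list_of_multiset (image_mset g (mset_set B)) = sort (map g bs0)"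
    using bs0 by (metis mset_map mset_set_set sorted_list_of_multiset_mset)
  also have "\<dots> = map g (sort_key g bs0)"
    by (rule properties_for_sort) auto
  finally have sv': "singular_values A = map g bs"
    unfolding sv g_def[symmetric] by (simp add: bs_def rev_map)
  have sv_nth: "singular_value (Suc i) A = g (bs ! i)" if "i < CARD('d)" for i
    using that by (simp add: singular_value_def sv' bs)
  obtain idx :: "'d \<Rightarrow> nat" where idx: "bij_betw idx UNIV {..<CARD('d)}"
    using ex_bij_betw_finite_nat[of "UNIV :: 'd set"] by (auto simp: atLeast0LessThan)
  then have idx_less: "idx k < CARD('d)" for k
    by (auto simp: bij_betw_def)
  define v where "v k = bs ! idx k" for k
  have vB: "v k \<in> B" for k
    using bs idx_less by (auto simp: v_def)
  have inj: "v j = v k \<longleftrightarrow> j = k" for j k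
    using bs idx_less idx by (auto simp: v_def nth_eq_iff_index_eq bij_betw_def inj_on_def)
  have rangev: "range v = B"
    by (rule card_subset_eq) (use B vB inj in \<open>auto simp: cardB card_image inj_on_def\<close>)
  have orthn: "v j \<bullet> v k = (if j = k then 1 else 0)" for j k
    using B(3,4) vB inj[of j k] by (auto simp: pairwise_def orthogonal_def norm_eq_1)
  have norm_eq: "(norm (A *v x))\<^sup>2 = (\<Sum>k\<in>UNIV. (singular_value (Suc (idx k)) A * (x \<bullet> v k))\<^sup>2)" for x
  proof -
    have "(norm (A *v x))\<^sup>2 = (M *v x) \<bullet> x"
      by (simp add: M power2_norm_eq_inner)
    also have "\<dots> = x \<bullet> (M *v x)" by (simp add: inner_commute)
    also have "\<dots> = x \<bullet> (M *v (\<Sum>b\<in>B. (x \<bullet> b) *\<^sub>R b))"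
      using orthonormal_expansion[OF B(1) spanB B(3,4), of x] by simp
    also have "\<dots> = (\<Sum>b\<in>B. (x \<bullet> b) * (x \<bullet> (M *v b)))"
      by (simp add: linear_sum[OF matrix_vector_mul_linear] inner_sum_right
          matrix_vector_mult_scaleR)
    also have "\<dots> = (\<Sum>b\<in>B. (g b * (x \<bullet> b))\<^sup>2)"
    proof (rule sum.cong[OF refl])
      fix b assume "b \<in> B"
      moreover have "(g b)\<^sup>2 = lam b" by (simp add: g_def lam_def)
      ultimately show "(x \<bullet> b) * (x \<bullet> (M *v b)) = (g b * (x \<bullet> b))\<^sup>2"
        by (simp add: lam power_mult_distrib) (simp add: power2_eq_square)
    qed
    also have "\<dots> = (\<Sum>k\<in>UNIV. (g (v k) * (x \<bullet> v k))\<^sup>2)"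
      unfolding rangev[symmetric] by (subst sum.reindex) (auto simp: inj_on_def inj)
    finally show ?thesis
      using sv_nth idx_less by (simp add: v_def)
  qed
  have sorted: "singular_value (Suc j) A \<le> singular_value (Suc i) A" if "i \<le> j" "j < CARD('d)" for i j
  proof -
    have "sorted (rev (map g bs))"
      by (simp add: bs_def rev_map[symmetric])
    from sorted_rev_nth_mono[OF this, of i j] show ?thesis
      using that bs by (simp add: sv_nth)
  qed
  have "0 \<le> singular_value (Suc i) A" if "i < CARD('d)" for i
    using that by (simp add: sv_nth g_def lam_def)
  with idx orthn norm_eq sorted have "right_singular_basis A idx v"
    by (simp add: right_singular_basis_def)
  then show ?thesis by (rule that)
qed


text \<open>
  The exponent with which singular value number \<open>i + 1\<close> enters the singular value function: \<open>1\<close> for the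
  first \<open>m\<close>, then the fractional remainder \<open>s - m\<close>, then \<open>0\<close>.  For \<open>s = 0\<close> the truncation gives
  \<open>m = 0\<close> and all exponents vanish.
\<close>

definition sv_exponent :: "real \<Rightarrow> nat \<Rightarrow> real" where
  "sv_exponent s i = (let m = nat (\<lceil>s\<rceil> - 1) in if i < m then 1 else if i = m then s - real m else 0)"

lemma sv_exponent_bounds:
  assumes "0 \<le> s"
  shows "0 \<le> sv_exponent s i" "sv_exponent s i \<le> 1"
proof -
  define m where "m = nat (\<lceil>s\<rceil> - 1)"
  have "real m \<le> s" "s \<le> real m + 1"
    using assms unfolding m_def by linarith+
  then show "0 \<le> sv_exponent s i" "sv_exponent s i \<le> 1"
    by (auto simp: sv_exponent_def Let_def m_def[symmetric])
qed

lemma sv_exponent_index_less: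
  assumes "0 \<le> s" "s \<le> real d" "0 < d"
  shows "nat (\<lceil>s\<rceil> - 1) < d"
  using assms by linarith

lemma prod_sv_exponent:
  fixes F :: "real \<Rightarrow> nat \<Rightarrow> 'a::comm_monoid_mult"
  assumes "0 \<le> s" "s \<le> real d" "0 < d" and "\<And>i. F 0 i = 1"
  shows "(\<Prod>i<d. F (sv_exponent s i) i) = (\<Prod>i<nat (\<lceil>s\<rceil> - 1). F 1 i) *
    F (s - real (nat (\<lceil>s\<rceil> - 1))) (nat (\<lceil>s\<rceil> - 1))"
proof -
  define m where "m = nat (\<lceil>s\<rceil> - 1)"
  have m: "m < d" using sv_exponent_index_less[OF assms(1-3)] by (simp add: m_def)
  have "(\<Prod>i<d. F (sv_exponent s i) i) = (\<Prod>i<Suc m. F (sv_exponent s i) i)"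
    using m assms(4) by (intro prod.mono_neutral_right) (auto simp: sv_exponent_def m_def[symmetric])
  also have "\<dots> = (\<Prod>i<m. F (sv_exponent s i) i) * F (sv_exponent s m) m"
    by simp
  also have "(\<Prod>i<m. F (sv_exponent s i) i) = (\<Prod>i<m. F 1 i)"
    by (intro prod.cong) (auto simp: sv_exponent_def m_def[symmetric])
  also have "sv_exponent s m = s - real m"
    by (simp add: sv_exponent_def m_def[symmetric])
  finally show ?thesis by (simp add: m_def)
qed

lemma sum_sv_exponent:
  assumes "0 \<le> s" "s \<le> real d" "0 < d"
  shows "(\<Sum>i<d. sv_exponent s i) = s"
proof -
  define m where "m = nat (\<lceil>s\<rceil> - 1)"
  have m: "m < d" using sv_exponent_index_less[OF assms(1-3)] by (simp add: m_def)
  have "(\<Sum>i<d. sv_exponent s i) = (\<Sum>i<Suc m. sv_exponent s i)"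
    using m by (intro sum.mono_neutral_right) (auto simp: sv_exponent_def m_def[symmetric])
  also have "\<dots> = s"
    by (simp add: sv_exponent_def m_def[symmetric])
  finally show ?thesis .
qed

lemma singular_value_pos:
  fixes A :: "real^'d^'d"
  assumes "invertible A" "i < CARD('d)"
  shows "0 < singular_value (Suc i) A"
proof -
  obtain idx v where basis: "right_singular_basis A idx v"
    by (rule singular_value_decomposition)
  then have idx: "bij_betw idx UNIV {..<CARD('d)}"
    and v: "\<And>j k. v j \<bullet> v k = (if j = k then 1 else 0)"
    and nrm: "\<And>x. (norm (A *v x))\<^sup>2 = (\<Sum>k\<in>UNIV. (singular_value (Suc (idx k)) A * (x \<bullet> v k))\<^sup>2)"
    and mono: "\<And>i j. i \<le> j \<Longrightarrow> j < CARD('d) \<Longrightarrow> singular_value (Suc j) A \<le> singular_value (Suc i) A"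
    and nn: "\<And>i. i < CARD('d) \<Longrightarrow> 0 \<le> singular_value (Suc i) A"
    unfolding right_singular_basis_def by blast+
  have "i \<in> range idx" using idx assms(2) by (simp add: bij_betw_def)
  then obtain k where k: "idx k = i" by auto
  have "(norm (A *v v k))\<^sup>2 = (\<Sum>j\<in>UNIV. if j = k then (singular_value (Suc (idx j)) A)\<^sup>2 else 0)"
    unfolding nrm by (intro sum.cong) (auto simp: v)
  then have eq: "(norm (A *v v k))\<^sup>2 = (singular_value (Suc i) A)\<^sup>2"
    by (simp add: k)
  obtain B where B: "B ** A = mat 1" using assms(1) by (auto simp: invertible_def)
  have "v k \<noteq> 0" using v[of k k] by auto
  moreover have "B *v (A *v v k) = v k"
    by (simp only: matrix_vector_mul_assoc B matrix_vector_mul_lid)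
  ultimately have "A *v v k \<noteq> 0" by auto
  then have "singular_value (Suc i) A \<noteq> 0" using eq by auto
  with nn[OF assms(2)] show ?thesis by linarith
qed

text \<open>
  Writing \<open>\<phi>\<^sup>s\<close> as one product over all singular values, with exponents in \<open>[0, 1]\<close> that add up to \<open>s\<close>,
  lets every estimate below be made factor by factor, with no distinction according to \<open>m\<close>.
\<close>

lemma singular_value_function_eq_prod:
  fixes A :: "real^'d^'d"
  assumes A: "invertible A" and s: "0 \<le> s" "s \<le> real CARD('d)"
  shows "singular_value_function s A = (\<Prod>i<CARD('d). singular_value (Suc i) A powr sv_exponent s i)"
proof -
  define m where "m = nat (\<lceil>s\<rceil> - 1)"
  have m: "m < CARD('d)" using sv_exponent_index_less[OF s] by (simp add: m_def)
  have pos: "0 < singular_value (Suc i) A" if "i \<le> m" for i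
    using singular_value_pos[OF A, of i] that m by simp
  \<comment> \<open>The case distinction makes \<open>F 0 i = 1\<close> hold also for indices \<open>i\<close> beyond the last singular value.\<close>
  define F where "F t i = (if t = 0 then 1 else singular_value (Suc i) A powr t)" for t i
  have "(\<Prod>i<CARD('d). singular_value (Suc i) A powr sv_exponent s i) = (\<Prod>i<CARD('d). F (sv_exponent s i) i)"
    using singular_value_pos[OF A] by (intro prod.cong) (auto simp: F_def less_imp_neq[symmetric])
  also have "\<dots> = (\<Prod>i<m. F 1 i) * F (s - real m) m"
    unfolding m_def by (rule prod_sv_exponent) (use s in \<open>auto simp: F_def\<close>)
  also have "(\<Prod>i<m. F 1 i) = (\<Prod>i<m. singular_value (Suc i) A)"
    using pos by (intro prod.cong) (auto simp: F_def less_imp_le)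
  also have "F (s - real m) m = singular_value (Suc m) A powr (s - real m)"
    using pos[of m] by (auto simp: F_def)
  also have "(\<Prod>i<m. singular_value (Suc i) A) = (\<Prod>k=1..m. singular_value k A)"
    by (rule prod.reindex_bij_witness[of _ "\<lambda>k. k - 1" Suc]) auto
  finally have *: "(\<Prod>i<CARD('d). singular_value (Suc i) A powr sv_exponent s i) =
    (\<Prod>k=1..m. singular_value k A) * singular_value (m + 1) A powr (s - real m)" by simp
  show ?thesis
  proof (cases "s = 0")
    case True
    then have "m = 0" by (simp add: m_def)
    with * True pos[of 0] show ?thesis by (simp add: singular_value_function_def)
  next
    case False
    with * show ?thesis by (simp add: singular_value_function_def m_def[symmetric] Let_def)
  qed
qed

text \<open>
  The data used by all geometric estimates: an orthonormal basis \<open>v\<close> of right singular vectors, the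
  singular values \<open>g\<close>, their exponents \<open>e\<close> in \<open>\<phi>\<^sup>s\<close>, and the critical direction \<open>k0\<close>, that of singular
  value number \<open>m + 1\<close>.  The last clause says that any other direction either is stretched at least as
  much as the critical one and enters \<open>\<phi>\<^sup>s\<close> with exponent \<open>1\<close>, or at most as much and does not enter.
\<close>

definition singular_frame ::
  "real \<Rightarrow> real^'d^'d \<Rightarrow> ('d \<Rightarrow> real^'d) \<Rightarrow> ('d \<Rightarrow> real) \<Rightarrow> ('d \<Rightarrow> real) \<Rightarrow> 'd \<Rightarrow> bool" where
  "singular_frame s A v g e k0 \<longleftrightarrow>
     (\<forall>j k. v j \<bullet> v k = (if j = k then 1 else 0)) \<and>
     (\<forall>x. (norm (A *v x))\<^sup>2 = (\<Sum>k\<in>UNIV. (g k * (x \<bullet> v k))\<^sup>2)) \<and>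
     (\<forall>k. 0 < g k) \<and> (\<forall>k. 0 \<le> e k) \<and> (\<forall>k. e k \<le> 1) \<and> (\<Sum>k\<in>UNIV. e k) = s \<and>
     singular_value_function s A = (\<Prod>k\<in>UNIV. g k powr e k) \<and>
     (\<forall>k. k = k0 \<or> (e k = 1 \<and> g k0 \<le> g k) \<or> (e k = 0 \<and> g k \<le> g k0))"

lemma singular_frame_exists:
  fixes A :: "real^'d^'d"
  assumes A: "invertible A" and s: "0 \<le> s" "s \<le> real CARD('d)"
  obtains v g e k0 where "singular_frame s A v g e k0"
proof -
  obtain idx v where basis: "right_singular_basis A idx v"
    by (rule singular_value_decomposition)
  then have idx: "bij_betw idx UNIV {..<CARD('d)}"
    and v: "\<And>j k. v j \<bullet> v k = (if j = k then 1 else 0)"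
    and nrm: "\<And>x. (norm (A *v x))\<^sup>2 = (\<Sum>k\<in>UNIV. (singular_value (Suc (idx k)) A * (x \<bullet> v k))\<^sup>2)"
    and mono: "\<And>i j. i \<le> j \<Longrightarrow> j < CARD('d) \<Longrightarrow> singular_value (Suc j) A \<le> singular_value (Suc i) A"
    and nn: "\<And>i. i < CARD('d) \<Longrightarrow> 0 \<le> singular_value (Suc i) A"
    unfolding right_singular_basis_def by blast+
  have idx_less: "idx k < CARD('d)" for k using idx by (auto simp: bij_betw_def)
  define m where "m = nat (\<lceil>s\<rceil> - 1)"
  have m: "m < CARD('d)" using sv_exponent_index_less[OF s] by (simp add: m_def)
  have "m \<in> range idx" using idx m by (simp add: bij_betw_def)
  then obtain k0 where k0: "idx k0 = m" by auto
  define g where "g k = singular_value (Suc (idx k)) A" for k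
  define e where "e k = sv_exponent s (idx k)" for k
  have "singular_frame s A v g e k0"
    unfolding singular_frame_def
  proof (intro conjI allI)
    show "v j \<bullet> v k = (if j = k then 1 else 0)" for j k by (rule v)
    show "(norm (A *v x))\<^sup>2 = (\<Sum>k\<in>UNIV. (g k * (x \<bullet> v k))\<^sup>2)" for x
      unfolding g_def by (rule nrm)
    show "0 < g k" for k unfolding g_def by (rule singular_value_pos[OF A idx_less])
    show "0 \<le> e k" "e k \<le> 1" for k unfolding e_def using sv_exponent_bounds[OF s(1)] by auto
    show "(\<Sum>k\<in>UNIV. e k) = s"
      unfolding e_def sum.reindex_bij_betw[OF idx] using s by (intro sum_sv_exponent) auto
    show "singular_value_function s A = (\<Prod>k\<in>UNIV. g k powr e k)"
      unfolding e_def g_def singular_value_function_eq_prod[OF A s]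
      using prod.reindex_bij_betw[OF idx, of "\<lambda>i. singular_value (Suc i) A powr sv_exponent s i"]
      by simp
    show "k = k0 \<or> (e k = 1 \<and> g k0 \<le> g k) \<or> (e k = 0 \<and> g k \<le> g k0)" for k
    proof -
      have "k = k0" if "idx k = m"
        using that k0 idx by (auto simp: bij_betw_def inj_on_def)
      moreover have "e k = 1 \<and> g k0 \<le> g k" if "idx k < m"
        using that m mono[of "idx k" m] by (simp add: e_def g_def k0 sv_exponent_def m_def[symmetric])
      moreover have "e k = 0 \<and> g k \<le> g k0" if "m < idx k"
        using that idx_less[of k] mono[of m "idx k"] by (simp add: e_def g_def k0 sv_exponent_def m_def[symmetric])
      ultimately show ?thesis by (metis linorder_neqE_nat)
    qed
  qed
  then show ?thesis by (rule that)
qed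

text \<open>
  A family of \<open>d\<close> orthonormal vectors in dimension \<open>d\<close> spans, so this is Parseval's identity.
\<close>

lemma orthonormal_family_norm:
  fixes v :: "'d::finite \<Rightarrow> real^'d"
  assumes v: "\<And>j k. v j \<bullet> v k = (if j = k then 1 else 0)"
  shows "(norm x)\<^sup>2 = (\<Sum>k\<in>UNIV. (x \<bullet> v k)\<^sup>2)"
proof -
  have inj: "inj v"
    by (rule injI) (metis v zero_neq_one)
  have "pairwise orthogonal (range v)"
    by (auto simp: pairwise_def orthogonal_def v)
  moreover have n1: "norm b = 1" if "b \<in> range v" for b
    using that v by (auto simp: norm_eq_1)
  moreover have "0 \<notin> range v" using n1[of 0] by auto
  ultimately have "independent (range v)" by (simp add: pairwise_orthogonal_independent)
  then have "span (range v) = UNIV"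
    using card_image[OF inj] card_eq_dim[of "range v" UNIV] by auto
  then have "x = (\<Sum>b\<in>range v. (x \<bullet> b) *\<^sub>R b)"
    using \<open>pairwise orthogonal (range v)\<close> n1 by (intro orthonormal_expansion) auto
  also have "\<dots> = (\<Sum>k\<in>UNIV. (x \<bullet> v k) *\<^sub>R v k)"
    by (subst sum.reindex[OF inj]) simp
  finally have "x \<bullet> x = x \<bullet> (\<Sum>k\<in>UNIV. (x \<bullet> v k) *\<^sub>R v k)"
    by simp
  then show ?thesis
    by (simp add: power2_norm_eq_inner inner_sum_right) (simp add: power2_eq_square)
qed


section \<open>Covering the linear image of a ball\<close>

lemma singular_frame_le:
  assumes fr: "singular_frame s A v g e k0" and A: "\<And>x. norm (A *v x) \<le> \<theta> * norm x"
  shows "g k \<le> \<theta>"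
proof -
  have v: "\<And>j k. v j \<bullet> v k = (if j = k then 1 else 0)"
    and nrm: "\<And>x. (norm (A *v x))\<^sup>2 = (\<Sum>k\<in>UNIV. (g k * (x \<bullet> v k))\<^sup>2)"
    and g: "\<And>k. 0 < g k"
    using fr by (simp_all add: singular_frame_def)
  have "(norm (A *v v k))\<^sup>2 = (\<Sum>j\<in>UNIV. if j = k then (g j)\<^sup>2 else 0)"
    unfolding nrm by (intro sum.cong) (auto simp: v)
  then have "(norm (A *v v k))\<^sup>2 = (g k)\<^sup>2" by simp
  then have "norm (A *v v k) = g k"
    using g[of k] by (simp add: power2_eq_iff_nonneg less_imp_le)
  moreover have "norm (v k) = 1" using v[of k k] by (simp add: norm_eq_1)
  ultimately show ?thesis using A[of "v k"] by simp
qed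

lemma singular_value_function_pos:
  fixes A :: "real^'d^'d"
  assumes "invertible A" "0 \<le> s" "s \<le> real CARD('d)"
  shows "0 < singular_value_function s A"
proof -
  obtain v g e k0 where "singular_frame s A v g e k0"
    using singular_frame_exists[OF assms] .
  then show ?thesis
    by (auto simp: singular_frame_def less_imp_neq[symmetric] intro!: prod_pos)
qed

lemma singular_value_function_le_powr:
  fixes A :: "real^'d^'d"
  assumes "invertible A" "0 \<le> s" "s \<le> real CARD('d)" and A: "\<And>x. norm (A *v x) \<le> \<theta> * norm x"
  shows "singular_value_function s A \<le> \<theta> powr s"
proof -
  obtain v g e k0 where fr: "singular_frame s A v g e k0"
    using singular_frame_exists[OF assms(1-3)] .
  then have g: "\<And>k. 0 < g k" and e: "\<And>k. 0 \<le> e k" "(\<Sum>k\<in>UNIV. e k) = s"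
    and sv: "singular_value_function s A = (\<Prod>k\<in>UNIV. g k powr e k)"
    by (simp_all add: singular_frame_def)
  have le: "g k \<le> \<theta>" for k using fr A by (rule singular_frame_le)
  have "0 < \<theta>" using g le by (meson less_le_trans)
  have "(\<Prod>k\<in>UNIV. g k powr e k) \<le> (\<Prod>k\<in>UNIV. \<theta> powr e k)"
    using g le e by (intro prod_mono) (auto intro!: powr_mono2 simp: less_imp_le)
  also have "\<dots> = \<theta> powr s"
    using \<open>0 < \<theta>\<close> by (simp add: powr_sum e(2)[symmetric])
  finally show ?thesis by (simp add: sv)
qed

text \<open>
  Divide the cube that contains the ball, in coordinates along the frame, into boxes whose images have
  all sides at most \<open>g k0\<close>: side \<open>g k0 / g k\<close> in the strongly stretched directions and \<open>1\<close> in the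
  others.  The number of boxes is about the product of the reciprocal sides, and by the last clause of
  the definition of a frame this product is exactly \<open>\<phi>\<^sup>s / (g k0)\<^sup>s\<close>.
\<close>

lemma ball_image_cover:
  fixes A :: "real^'d^'d"
  assumes fr: "singular_frame s A v g e k0" and R: "0 \<le> R"
  obtains P where "finite P"
    "real (card P) * g k0 powr s \<le> (2 * R + 1) ^ CARD('d) * singular_value_function s A"
    "(*v) A ` cball 0 R \<subseteq> (\<Union>p\<in>P. cball p (real CARD('d) * g k0))"
proof -
  have v: "\<And>j k. v j \<bullet> v k = (if j = k then 1 else 0)"
    and nrm: "\<And>x. (norm (A *v x))\<^sup>2 = (\<Sum>k\<in>UNIV. (g k * (x \<bullet> v k))\<^sup>2)"
    and g: "\<And>k. 0 < g k" and e: "(\<Sum>k\<in>UNIV. e k) = s"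
    and sv: "singular_value_function s A = (\<Prod>k\<in>UNIV. g k powr e k)"
    and cases: "\<And>k. k = k0 \<or> (e k = 1 \<and> g k0 \<le> g k) \<or> (e k = 0 \<and> g k \<le> g k0)"
    using fr by (simp_all add: singular_frame_def)
  define r where "r k = min 1 (g k0 / g k)" for k
  have r: "0 < r k" "r k \<le> 1" "g k * r k \<le> g k0" for k
    using g[of k] g[of k0] by (auto simp: r_def min_def field_simps)
  define J where "J k = {0..nat \<lfloor>2 * R / r k\<rfloor>}" for k
  define pt where "pt j = A *v (\<Sum>k\<in>UNIV. (- R + real (j k) * r k) *\<^sub>R v k)" for j :: "'d \<Rightarrow> nat"
  define P where "P = pt ` (PiE UNIV J)"
  have fin: "finite (PiE UNIV J)"
    by (intro finite_PiE) (auto simp: J_def)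
  have cardJ: "real (card (J k)) \<le> (2 * R + 1) / r k" for k
  proof -
    have "real (card (J k)) = of_int \<lfloor>2 * R / r k\<rfloor> + 1"
      using R r[of k] by (simp add: J_def)
    also have "\<dots> \<le> 2 * R / r k + 1 / r k"
      using r[of k] by (intro add_mono) (auto simp: field_simps)
    finally show ?thesis by (simp add: add_divide_distrib)
  qed
  \<comment> \<open>Distributing \<open>(g k0)\<^sup>s\<close> over the directions according to the exponents turns each factor of the box
    count into the corresponding factor of \<open>\<phi>\<^sup>s\<close>.\<close>
  have factor: "g k0 powr e k / r k = g k powr e k" for k
    using cases[of k] g[of k] g[of k0]
    by (auto simp: r_def min_def field_simps)
  have "card P \<le> card (PiE UNIV J)"
    unfolding P_def using fin by (rule card_image_le)
  then have "real (card P) \<le> (\<Prod>k\<in>UNIV. real (card (J k)))"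
    by (simp add: card_PiE flip: of_nat_prod)
  also have "\<dots> \<le> (\<Prod>k\<in>UNIV. (2 * R + 1) / r k)"
    by (intro prod_mono) (simp add: cardJ)
  finally have "real (card P) * g k0 powr s \<le> (\<Prod>k\<in>UNIV. (2 * R + 1) / r k) * g k0 powr s"
    by (intro mult_right_mono) auto
  also have "(\<Prod>k\<in>UNIV. (2 * R + 1) / r k) * g k0 powr s
      = (\<Prod>k\<in>UNIV. (2 * R + 1) / r k) * (\<Prod>k\<in>UNIV. g k0 powr e k)"
    using g[of k0] by (simp add: powr_sum flip: e)
  also have "\<dots> = (\<Prod>k\<in>UNIV. (2 * R + 1) * (g k0 powr e k / r k))"
    by (simp add: prod.distrib[symmetric])
  also have "\<dots> = (2 * R + 1) ^ CARD('d) * singular_value_function s A"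
    unfolding factor sv by (simp add: prod.distrib)
  finally have card: "real (card P) * g k0 powr s \<le> (2 * R + 1) ^ CARD('d) * singular_value_function s A" .
  have cover: "(*v) A ` cball 0 R \<subseteq> (\<Union>p\<in>P. cball p (real CARD('d) * g k0))"
  proof (intro subsetI)
    fix y assume "y \<in> (*v) A ` cball 0 R"
    then obtain x where x: "norm x \<le> R" and y: "y = A *v x" by auto
    define j where "j k = nat \<lfloor>(x \<bullet> v k + R) / r k\<rfloor>" for k
    have xv: "\<bar>x \<bullet> v k\<bar> \<le> R" for k
      using Cauchy_Schwarz_ineq2[of x "v k"] v[of k k] x by (simp add: norm_eq_1[THEN iffD2])
    have jJ: "j k \<in> J k" for k
    proof -
      have "(x \<bullet> v k + R) / r k \<le> 2 * R / r k"
        using xv[of k] r[of k] by (intro divide_right_mono) auto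
      then show ?thesis
        by (auto simp: j_def J_def intro!: nat_mono floor_mono)
    qed
    have jx: "\<bar>(x - (\<Sum>k\<in>UNIV. (- R + real (j k) * r k) *\<^sub>R v k)) \<bullet> v i\<bar> \<le> r i" for i
    proof -
      have "(\<Sum>k\<in>UNIV. (- R + real (j k) * r k) *\<^sub>R v k) \<bullet> v i
          = (\<Sum>k\<in>UNIV. if k = i then - R + real (j k) * r k else 0)"
        unfolding inner_sum_left by (intro sum.cong) (auto simp: v)
      then have eq: "(x - (\<Sum>k\<in>UNIV. (- R + real (j k) * r k) *\<^sub>R v k)) \<bullet> v i
          = x \<bullet> v i + R - real (j i) * r i"
        by (simp add: inner_diff_left)
      have "0 \<le> (x \<bullet> v i + R) / r i"
        using xv[of i] r[of i] by (simp add: abs_le_iff)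
      then have "real (j i) \<le> (x \<bullet> v i + R) / r i" "(x \<bullet> v i + R) / r i \<le> real (j i) + 1"
        unfolding j_def by linarith+
      then show ?thesis
        unfolding eq using r[of i] by (auto simp: field_simps abs_le_iff)
    qed
    have "(dist (pt j) y)\<^sup>2 = (\<Sum>k\<in>UNIV. (g k * ((x - (\<Sum>k\<in>UNIV. (- R + real (j k) * r k) *\<^sub>R v k)) \<bullet> v k))\<^sup>2)"
      unfolding nrm[symmetric] y pt_def
      by (subst dist_commute) (simp only: dist_norm matrix_vector_mult_diff_distrib)
    also have "\<dots> \<le> (\<Sum>k\<in>(UNIV :: 'd set). (g k0)\<^sup>2)"
    proof (rule sum_mono)
      fix k
      have "\<bar>g k * ((x - (\<Sum>k\<in>UNIV. (- R + real (j k) * r k) *\<^sub>R v k)) \<bullet> v k)\<bar> \<le> g k * r k"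
        using jx[of k] g[of k] by (simp add: abs_mult)
      also have "\<dots> \<le> g k0" by (rule r)
      finally show "(g k * ((x - (\<Sum>k\<in>UNIV. (- R + real (j k) * r k) *\<^sub>R v k)) \<bullet> v k))\<^sup>2 \<le> (g k0)\<^sup>2"
        using g[of k0] by (simp add: abs_le_square_iff[symmetric])
    qed
    also have "\<dots> \<le> (real CARD('d) * g k0)\<^sup>2"
    proof -
      have "real CARD('d) * (g k0)\<^sup>2 \<le> (real CARD('d))\<^sup>2 * (g k0)\<^sup>2"
        by (intro mult_right_mono) (auto simp: power2_eq_square)
      then show ?thesis by (simp add: power_mult_distrib)
    qed
    finally have "dist (pt j) y \<le> real CARD('d) * g k0"
      by (rule power2_le_imp_le) (use g[of k0] in simp)
    then show "y \<in> (\<Union>p\<in>P. cball p (real CARD('d) * g k0))"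
      unfolding P_def using jJ by (intro UN_I[of "pt j"]) auto
  qed
  show ?thesis
    by (rule that[of P]) (use fin card cover in \<open>auto simp: P_def\<close>)
qed


section \<open>Integrating the Riesz kernel along affine maps\<close>

text \<open>
  The value \<open>\<infinity>\<close> at \<open>0\<close> is set explicitly, as \<open>0 powr - t = 0\<close>.
\<close>

definition riesz_kernel :: "real \<Rightarrow> 'a::real_normed_vector \<Rightarrow> ennreal" where
  "riesz_kernel t z = (if z = 0 then \<infinity> else ennreal (norm z powr - t))"

lemma measurable_riesz_kernel[measurable]:
  "(riesz_kernel t :: 'a::euclidean_space \<Rightarrow> ennreal) \<in> borel_measurable borel"
  unfolding riesz_kernel_def by measurable


lemma nn_integral_lborel_plus:
  fixes f :: "'a::euclidean_space \<Rightarrow> ennreal"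
  assumes [measurable]: "f \<in> borel_measurable borel"
  shows "(\<integral>\<^sup>+x. f (c + x) \<partial>lborel) = (\<integral>\<^sup>+x. f x \<partial>lborel)"
proof -
  have "(\<integral>\<^sup>+x. f x \<partial>lborel) = (\<integral>\<^sup>+x. f x \<partial>(distr lborel borel ((+) c)))"
    by (simp add: lborel_distr_plus)
  then show ?thesis by (simp add: nn_integral_distr)
qed

text \<open>
  The image of Lebesgue measure under \<open>M\<close> is translation invariant, hence a multiple of Lebesgue measure,
  and the factor is found by testing on a ball: \<open>M\<close> pulls the unit ball back into the ball of radius
  \<open>1 / c\<close>.  The proof is the usual double integral for uniqueness of Haar measure; it needs no
  determinants.
\<close>

lemma nn_integral_expanding_affine_le:
  fixes M :: "'a::euclidean_space \<Rightarrow> 'a" and f :: "'a \<Rightarrow> ennreal"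
  assumes lin: "linear M" and c: "c > 0" and exp: "\<And>x. c * norm x \<le> norm (M x)"
    and [measurable]: "f \<in> borel_measurable borel"
  shows "emeasure lborel (cball 0 1 :: 'a set) * (\<integral>\<^sup>+t. f (b + M t) \<partial>lborel)
       \<le> emeasure lborel (cball 0 (1 / c) :: 'a set) * (\<integral>\<^sup>+x. f x \<partial>lborel)"
proof -
  interpret M: linear M by fact
  have M_meas[measurable]: "M \<in> borel_measurable borel"
    using lin by (intro borel_measurable_continuous_onI linear_continuous_on)
      (simp add: linear_conv_bounded_linear)
  have "inj M"
  proof (rule injI)
    fix x y assume "M x = M y"
    then have "norm (M (x - y)) = 0" by (simp add: M.diff)
    then have "c * norm (x - y) \<le> 0" using exp[of "x - y"] by simp
    then show "x = y" using c by (simp add: mult_le_0_iff)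
  qed
  then have "surj M" using lin linear_injective_imp_surjective by blast
  have inv: "(\<integral>\<^sup>+t. h (z + M t) \<partial>lborel) = (\<integral>\<^sup>+t. h (M t) \<partial>lborel)"
    if [measurable]: "h \<in> borel_measurable borel" for z and h :: "'a \<Rightarrow> ennreal"
  proof -
    obtain y where "z = M y" using \<open>surj M\<close> by (auto simp: surj_def)
    then show ?thesis
      using nn_integral_lborel_plus[of "\<lambda>t. h (M t)" y] by (simp add: M.add)
  qed
  define g :: "'a \<Rightarrow> ennreal" where "g = indicator (cball 0 1)"
  have [measurable]: "g \<in> borel_measurable borel" unfolding g_def by (intro borel_measurable_indicator borel_closed closed_cball)
  have "emeasure lborel (cball 0 1 :: 'a set) * (\<integral>\<^sup>+t. f (b + M t) \<partial>lborel)
      = (\<integral>\<^sup>+x. g x * (\<integral>\<^sup>+t. f (M t) \<partial>lborel) \<partial>lborel)"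
    unfolding inv[OF assms(4)] by (subst nn_integral_multc) (measurable, simp add: g_def)
  also have "\<dots> = (\<integral>\<^sup>+x. (\<integral>\<^sup>+t. g x * f (x + M t) \<partial>lborel) \<partial>lborel)"
    by (simp add: nn_integral_cmult inv)
  also have "\<dots> = (\<integral>\<^sup>+t. (\<integral>\<^sup>+x. g x * f (x + M t) \<partial>lborel) \<partial>lborel)"
    by (rule lborel_pair.Fubini') measurable
  also have "\<dots> = (\<integral>\<^sup>+t. (\<integral>\<^sup>+x. g (x - M t) * f x \<partial>lborel) \<partial>lborel)"
  proof (rule nn_integral_cong)
    fix t
    show "(\<integral>\<^sup>+x. g x * f (x + M t) \<partial>lborel) = (\<integral>\<^sup>+x. g (x - M t) * f x \<partial>lborel)"
      using nn_integral_lborel_plus[of "\<lambda>x. g (x - M t) * f x" "M t"]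
      by (simp add: add.commute)
  qed
  also have "\<dots> = (\<integral>\<^sup>+x. (\<integral>\<^sup>+t. g (x - M t) * f x \<partial>lborel) \<partial>lborel)"
    by (rule lborel_pair.Fubini') measurable
  also have "\<dots> = (\<integral>\<^sup>+x. (\<integral>\<^sup>+t. g (- M t) \<partial>lborel) * f x \<partial>lborel)"
  proof (rule nn_integral_cong)
    fix x
    have "(\<integral>\<^sup>+t. g (x - M t) \<partial>lborel) = (\<integral>\<^sup>+t. g (- M t) \<partial>lborel)"
      using inv[of "\<lambda>y. g (- y)" "- x"] by simp
    then show "(\<integral>\<^sup>+t. g (x - M t) * f x \<partial>lborel) = (\<integral>\<^sup>+t. g (- M t) \<partial>lborel) * f x"
      by (simp add: nn_integral_multc)
  qed
  also have "\<dots> = (\<integral>\<^sup>+t. g (- M t) \<partial>lborel) * (\<integral>\<^sup>+x. f x \<partial>lborel)"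
    by (simp add: nn_integral_cmult)
  also have "\<dots> \<le> (\<integral>\<^sup>+t. indicator (cball 0 (1 / c)) t \<partial>(lborel :: 'a measure)) * (\<integral>\<^sup>+x. f x \<partial>lborel)"
  proof (intro mult_right_mono nn_integral_mono)
    fix t :: 'a
    show "g (- M t) \<le> indicator (cball 0 (1 / c)) t"
      using exp[of t] c by (auto simp: g_def indicator_def field_simps)
  qed simp
  finally show ?thesis by simp
qed

text \<open>
  The integrand is infinite at the origin, so that a product of such factors in several coordinates is
  infinite as soon as one coordinate vanishes.
\<close>

lemma nn_integral_abs_powr_finite:
  fixes R :: real
  assumes "0 \<le> a" "a < 1" "0 \<le> R"
  shows "(\<integral>\<^sup>+r. indicator {-R..R} r * (if r = 0 then \<infinity> else ennreal (\<bar>r\<bar> powr - a)) \<partial>lborel) < \<infinity>"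
proof -
  define p where "p r = indicator {0..R} r * r powr - a" for r
  have p_meas[measurable]: "p \<in> borel_measurable borel"
    unfolding p_def by measurable
  have "((\<lambda>r. r powr - a) has_integral (R powr (- a + 1) / (- a + 1))) {0..R}"
    using assms by (intro has_integral_powr_from_0) auto
  then have "((\<lambda>r. if r \<in> {0..R} then r powr - a else 0) has_integral
      (R powr (- a + 1) / (- a + 1))) UNIV"
    by (simp only: has_integral_restrict_UNIV)
  moreover have "(\<lambda>r. if r \<in> {0..R} then r powr - a else 0) = p"
    by (auto simp: p_def fun_eq_iff)
  ultimately have "(p has_integral (R powr (- a + 1) / (- a + 1))) UNIV"
    by simp
  moreover have "0 \<le> p r" for r
    by (simp add: p_def)
  ultimately have p: "(\<integral>\<^sup>+r. ennreal (p r) \<partial>lborel) = ennreal (R powr (- a + 1) / (- a + 1))"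
    by (intro nn_integral_has_integral_lborel p_meas)
  have p': "(\<integral>\<^sup>+r. ennreal (p (- r)) \<partial>lborel) = (\<integral>\<^sup>+r. ennreal (p r) \<partial>lborel)"
    using nn_integral_distr[of uminus lborel borel "\<lambda>r. ennreal (p r)"]
    by (simp add: lborel_distr_uminus)
  have "(\<integral>\<^sup>+r. indicator {-R..R} r * (if r = 0 then \<infinity> else ennreal (\<bar>r\<bar> powr - a)) \<partial>lborel)
      \<le> (\<integral>\<^sup>+r. ennreal (p r) + ennreal (p (- r)) \<partial>lborel)"
  proof (rule nn_integral_mono_AE)
    show "AE r in lborel. indicator {-R..R} r * (if r = 0 then \<infinity> else ennreal (\<bar>r\<bar> powr - a))
            \<le> ennreal (p r) + ennreal (p (- r))"
      using AE_lborel_singleton[of "0::real"]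
    proof eventually_elim
      case (elim r)
      then show ?case
        by (cases "r > 0") (auto simp: p_def indicator_def)
    qed
  qed
  also have "\<dots> = ennreal (R powr (- a + 1) / (- a + 1)) + ennreal (R powr (- a + 1) / (- a + 1))"
    by (subst nn_integral_add) (auto simp: p p')
  also have "\<dots> < \<infinity>" by simp
  finally show ?thesis .
qed

text \<open>
  On \<open>[-R, R]\<close> this dominates \<open>\<bar>r\<bar>\<close> to the power \<open>- a\<close> for all \<open>a\<close> in \<open>[0, \<rho>]\<close> at once, so that the
  constants below do not depend on how the exponents are distributed over the coordinates.
\<close>

definition powr_majorant :: "real \<Rightarrow> real \<Rightarrow> real \<Rightarrow> ennreal" where
  "powr_majorant \<rho> R r =
     indicator {-R..R} r * (if r = 0 then \<infinity> else 1 + ennreal (\<bar>r\<bar> powr - \<rho>))"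

lemma measurable_powr_majorant[measurable]: "powr_majorant \<rho> R \<in> borel_measurable borel"
  unfolding powr_majorant_def by measurable

lemma nn_integral_powr_majorant_finite:
  assumes "0 \<le> \<rho>" "\<rho> < 1" "0 \<le> R"
  shows "(\<integral>\<^sup>+r. powr_majorant \<rho> R r \<partial>lborel) < \<infinity>"
proof -
  have "(\<integral>\<^sup>+r. powr_majorant \<rho> R r \<partial>lborel) = (\<integral>\<^sup>+r. indicator {-R..R} r +
      indicator {-R..R} r * (if r = 0 then \<infinity> else ennreal (\<bar>r\<bar> powr - \<rho>)) \<partial>lborel)"
    by (intro nn_integral_cong) (auto simp: powr_majorant_def indicator_def)
  also have "\<dots> = ennreal (2 * R) +
      (\<integral>\<^sup>+r. indicator {-R..R} r * (if r = 0 then \<infinity> else ennreal (\<bar>r\<bar> powr - \<rho>)) \<partial>lborel)"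
    using assms(3) by (subst nn_integral_add) simp_all
  also have "\<dots> < \<infinity>"
    using nn_integral_abs_powr_finite[OF assms] by simp
  finally show ?thesis .
qed

lemma nn_integral_prod_component:
  fixes h :: "real \<Rightarrow> ennreal"
  assumes [measurable]: "h \<in> borel_measurable borel"
  shows "(\<integral>\<^sup>+u. (\<Prod>k\<in>UNIV. h (u $ k)) \<partial>(lborel :: (real^'d) measure))
       = (\<integral>\<^sup>+r. h r \<partial>lborel) ^ CARD('d)"
proof -
  have Basis: "Basis = (\<lambda>k. axis k 1 :: real^'d) ` (UNIV :: 'd set)"
    by (auto simp: Basis_vec_def Basis_real_def)
  have inj: "inj (\<lambda>k. axis k 1 :: real^'d)"
    by (simp add: inj_on_def axis_eq_axis)
  have "(\<integral>\<^sup>+u. (\<Prod>k\<in>UNIV. h (u $ k)) \<partial>(lborel :: (real^'d) measure))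
      = (\<integral>\<^sup>+u. (\<Prod>b\<in>Basis. h (u \<bullet> b)) \<partial>(lborel :: (real^'d) measure))"
    unfolding Basis by (subst prod.reindex[OF inj]) (simp add: inner_axis)
  also have "\<dots> = (\<Prod>b\<in>(Basis :: (real^'d) set). \<integral>\<^sup>+r. h r \<partial>lborel)"
    by (rule nn_integral_lborel_prod) auto
  finally show ?thesis by simp
qed


text \<open>
  Since \<open>norm (A *v u)\<close> is at least \<open>g k * \<bar>u \<bullet> v k\<bar>\<close> for every \<open>k\<close>, one may split its power \<open>- \<rho> s\<close> into
  powers \<open>- \<rho> e k\<close> and estimate each by its own direction.  The singular values then combine to
  \<open>\<phi>\<^sup>s\<close> to the power \<open>- \<rho>\<close>.
\<close>

lemma riesz_kernel_le_prod:
  fixes A :: "real^'d^'d"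
  assumes fr: "singular_frame s A v g e k0" and rho: "0 \<le> \<rho>" and R: "norm u \<le> R"
  shows "riesz_kernel (\<rho> * s) (A *v u)
    \<le> ennreal (singular_value_function s A powr - \<rho>) * (\<Prod>k\<in>UNIV. powr_majorant \<rho> R (u \<bullet> v k))"
proof -
  have v: "\<And>j k. v j \<bullet> v k = (if j = k then 1 else 0)"
    and nrm: "\<And>x. (norm (A *v x))\<^sup>2 = (\<Sum>k\<in>UNIV. (g k * (x \<bullet> v k))\<^sup>2)"
    and g: "\<And>k. 0 < g k" and e: "(\<Sum>k\<in>UNIV. e k) = s" "\<And>k. 0 \<le> e k" "\<And>k. e k \<le> 1"
    and sv: "singular_value_function s A = (\<Prod>k\<in>UNIV. g k powr e k)"
    using fr by (simp_all add: singular_frame_def)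
  have uv: "u \<bullet> v k \<in> {-R..R}" for k
    using Cauchy_Schwarz_ineq2[of u "v k"] v[of k k] R by (auto simp: norm_eq_1[THEN iffD2] abs_le_iff)
  have sv_pos: "0 < singular_value_function s A"
    unfolding sv using g by (intro prod_pos) (auto simp: less_imp_neq[symmetric])
  show ?thesis
  proof (cases "\<exists>k. u \<bullet> v k = 0")
    case True
    then have "(\<Prod>k\<in>UNIV. powr_majorant \<rho> R (u \<bullet> v k)) = \<infinity>"
      using uv by (auto simp: ennreal_prod_eq_top powr_majorant_def)
    then show ?thesis using sv_pos by (simp add: ennreal_mult_eq_top_iff)
  next
    case False
    have low: "g k * \<bar>u \<bullet> v k\<bar> \<le> norm (A *v u)" for k
    proof -
      have "(g k * \<bar>u \<bullet> v k\<bar>)\<^sup>2 = (\<Sum>j\<in>{k}. (g j * (u \<bullet> v j))\<^sup>2)"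
        by (simp add: power_mult_distrib)
      also have "\<dots> \<le> (norm (A *v u))\<^sup>2"
        unfolding nrm by (intro sum_mono2) auto
      finally show ?thesis by (rule power2_le_imp_le) simp
    qed
    have pos: "0 < g k * \<bar>u \<bullet> v k\<bar>" for k using g[of k] False by simp
    have Apos: "0 < norm (A *v u)" using less_le_trans[OF pos low] .
    have "norm (A *v u) powr - (\<rho> * s) = (\<Prod>k\<in>UNIV. norm (A *v u) powr - (\<rho> * e k))"
    proof -
      have "- (\<rho> * s) = (\<Sum>k\<in>UNIV. - (\<rho> * e k))"
        by (simp add: sum_negf sum_distrib_left flip: e(1))
      then show ?thesis using Apos by (simp add: powr_sum)
    qed
    also have "\<dots> \<le> (\<Prod>k\<in>UNIV. (g k powr e k) powr - \<rho> * (1 + \<bar>u \<bullet> v k\<bar> powr - \<rho>))"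
    proof (rule prod_mono)
      fix k
      have "norm (A *v u) powr - (\<rho> * e k) \<le> (g k * \<bar>u \<bullet> v k\<bar>) powr - (\<rho> * e k)"
        using low pos rho e(2) by (intro powr_mono2') auto
      also have "\<dots> = (g k powr e k) powr - \<rho> * \<bar>u \<bullet> v k\<bar> powr - (\<rho> * e k)"
        using g[of k] by (simp add: powr_mult powr_powr mult.commute)
      also have "\<bar>u \<bullet> v k\<bar> powr - (\<rho> * e k) \<le> 1 + \<bar>u \<bullet> v k\<bar> powr - \<rho>"
      proof (cases "\<bar>u \<bullet> v k\<bar> \<le> 1")
        case True
        have "\<bar>u \<bullet> v k\<bar> powr - (\<rho> * e k) \<le> \<bar>u \<bullet> v k\<bar> powr - \<rho>"
          using True False rho e(2,3)[of k] by (intro powr_mono') (auto simp: mult_left_le)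
        then show ?thesis by simp
      next
        case False
        have "\<bar>u \<bullet> v k\<bar> powr - (\<rho> * e k) \<le> 1 powr - (\<rho> * e k)"
          using False rho e(2)[of k] by (intro powr_mono2') auto
        also have "\<dots> \<le> 1 + \<bar>u \<bullet> v k\<bar> powr - \<rho>" by simp
        finally show ?thesis .
      qed
      finally show "0 \<le> norm (A *v u) powr - (\<rho> * e k) \<and> norm (A *v u) powr - (\<rho> * e k)
          \<le> (g k powr e k) powr - \<rho> * (1 + \<bar>u \<bullet> v k\<bar> powr - \<rho>)"
        by (simp add: mult_left_mono)
    qed
    also have "\<dots> = singular_value_function s A powr - \<rho> * (\<Prod>k\<in>UNIV. 1 + \<bar>u \<bullet> v k\<bar> powr - \<rho>)"
      by (simp add: prod.distrib sv prod_powr_distrib)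
    finally have "riesz_kernel (\<rho> * s) (A *v u)
        \<le> ennreal (singular_value_function s A powr - \<rho> * (\<Prod>k\<in>UNIV. 1 + \<bar>u \<bullet> v k\<bar> powr - \<rho>))"
      using Apos by (auto simp: riesz_kernel_def intro!: ennreal_leI)
    also have "\<dots> = ennreal (singular_value_function s A powr - \<rho>) * (\<Prod>k\<in>UNIV. powr_majorant \<rho> R (u \<bullet> v k))"
    proof -
      have "powr_majorant \<rho> R (u \<bullet> v k) = ennreal (1 + \<bar>u \<bullet> v k\<bar> powr - \<rho>)" for k
        using uv[of k] False by (simp add: powr_majorant_def)
      then show ?thesis
        by (simp add: ennreal_mult prod_nonneg prod_ennreal del: ennreal_plus)
    qed
    finally show ?thesis .
  qed
qed

text \<open>
  The constant depends on \<open>s\<close>, \<open>\<rho>\<close>, \<open>c\<close>, \<open>R\<close> and the dimension only, not on \<open>A\<close>: coordinates along the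
  frame of \<open>A\<close> are an isometry, and the majorant of the kernel is the same in each of them.
\<close>

lemma nn_integral_riesz_kernel_affine_le:
  fixes s \<rho> c R :: real
  assumes s: "0 \<le> s" "s \<le> real CARD('d)" and rho: "0 \<le> \<rho>" "\<rho> < 1" and c: "0 < c" and R: "0 \<le> R"
  obtains K where "K < \<infinity>"
    "\<And>(A :: real^'d^'d) (D :: real^'d \<Rightarrow> real^'d) b S. invertible A \<Longrightarrow> linear D \<Longrightarrow> (\<And>x. c * norm x \<le> norm (D x)) \<Longrightarrow>
       (\<And>t. t \<in> S \<Longrightarrow> norm (b + D t) \<le> R) \<Longrightarrow>
       (\<integral>\<^sup>+t. indicator S t * riesz_kernel (\<rho> * s) (A *v (b + D t)) \<partial>lborel)
         \<le> K * ennreal (singular_value_function s A powr - \<rho>)"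
proof -
  define f where "f u = (\<Prod>k\<in>UNIV. powr_majorant \<rho> R (u $ k))" for u :: "real^'d"
  have f_meas[measurable]: "f \<in> borel_measurable borel"
    unfolding f_def by measurable
  define I where "I = (\<integral>\<^sup>+u. f u \<partial>lborel)"
  have I: "I < \<infinity>"
    unfolding I_def f_def
    using nn_integral_powr_majorant_finite[OF rho R]
    by (simp add: nn_integral_prod_component power_less_top_ennreal)
  define m1 where "m1 = emeasure lborel (cball 0 1 :: (real^'d) set)"
  define m2 where "m2 = emeasure lborel (cball 0 (1 / c) :: (real^'d) set)"
  have m2: "m2 < \<infinity>" and m1: "m1 < \<infinity>"
    unfolding m1_def m2_def by (rule emeasure_lborel_cball_finite)+
  have m1': "m1 \<noteq> 0"
  proof
    assume "m1 = 0"
    then have "measure lborel (cball 0 1 :: (real^'d) set) = 0"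
      by (simp add: m1_def measure_def)
    with content_cball_pos[of 1 "0 :: real^'d"] show False by simp
  qed
  show ?thesis
  proof (rule that[of "m2 * I / m1"])
    show "m2 * I / m1 < \<infinity>"
      using m1' m2 I by (simp add: ennreal_divide_eq_top_iff ennreal_mult_less_top less_top[symmetric] ennreal_mult_eq_top_iff)
  next
    fix A :: "real^'d^'d" and D :: "real^'d \<Rightarrow> real^'d" and b S
    assume A: "invertible A" and D: "linear D" and low: "\<And>x. c * norm x \<le> norm (D x)"
      and S: "\<And>t. t \<in> S \<Longrightarrow> norm (b + D t) \<le> R"
    obtain v g e k0 where fr: "singular_frame s A v g e k0"
      using singular_frame_exists[OF A s] .
    then have v: "\<And>j k. v j \<bullet> v k = (if j = k then 1 else 0)"
      by (simp add: singular_frame_def)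
    define V where "V x = (\<chi> k. x \<bullet> v k)" for x :: "real^'d"
    have linV: "linear V"
      by (rule linearI) (auto simp: V_def vec_eq_iff inner_add_left)
    define M where "M = V \<circ> D"
    have linM: "linear M" unfolding M_def using D linV by (rule linear_compose)
    have normV: "norm (V x) = norm x" for x
    proof -
      have "(norm (V x))\<^sup>2 = (\<Sum>k\<in>UNIV. (V x $ k)\<^sup>2)"
        unfolding power2_norm_eq_inner inner_vec_def by (simp add: power2_eq_square)
      also have "\<dots> = (norm x)\<^sup>2"
        unfolding orthonormal_family_norm[OF v, of x] by (simp add: V_def)
      finally have "(norm (V x))\<^sup>2 = (norm x)\<^sup>2" .
      then show ?thesis by (simp add: power2_eq_iff_nonneg)
    qed
    have M_low: "c * norm x \<le> norm (M x)" for x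
      by (simp add: M_def normV low)
    have M_meas: "M \<in> borel_measurable borel"
      using linM by (intro borel_measurable_continuous_onI linear_continuous_on)
        (simp add: linear_conv_bounded_linear)
    define \<Phi> where "\<Phi> = ennreal (singular_value_function s A powr - \<rho>)"
    have "(\<integral>\<^sup>+t. indicator S t * riesz_kernel (\<rho> * s) (A *v (b + D t)) \<partial>lborel)
        \<le> (\<integral>\<^sup>+t. \<Phi> * f (V b + M t) \<partial>lborel)"
    proof (rule nn_integral_mono)
      fix t
      show "indicator S t * riesz_kernel (\<rho> * s) (A *v (b + D t)) \<le> \<Phi> * f (V b + M t)"
      proof (cases "t \<in> S")
        case True
        have "f (V b + M t) = (\<Prod>k\<in>UNIV. powr_majorant \<rho> R ((b + D t) \<bullet> v k))"
          by (simp add: f_def M_def V_def inner_add_left)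
        then show ?thesis
          using riesz_kernel_le_prod[OF fr rho(1) S[OF True]] True by (simp add: \<Phi>_def)
      qed simp
    qed
    also have "\<dots> = \<Phi> * (\<integral>\<^sup>+t. f (V b + M t) \<partial>lborel)"
      using M_meas by (intro nn_integral_cmult) measurable
    also have "\<dots> \<le> \<Phi> * (m2 * I / m1)"
    proof -
      have "m1 * (\<integral>\<^sup>+t. f (V b + M t) \<partial>lborel) \<le> m2 * I"
        unfolding m1_def m2_def I_def
        by (rule nn_integral_expanding_affine_le[OF linM c M_low f_meas])
      then have "(\<integral>\<^sup>+t. f (V b + M t) \<partial>lborel) * m1 / m1 \<le> m2 * I / m1"
        by (intro divide_right_mono_ennreal) (simp add: mult.commute)
      then show ?thesis
        using m1 m1' by (intro mult_left_mono) (simp_all add: ennreal_mult_divide_eq)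
    qed
    finally show "(\<integral>\<^sup>+t. indicator S t * riesz_kernel (\<rho> * s) (A *v (b + D t)) \<partial>lborel)
         \<le> m2 * I / m1 * ennreal (singular_value_function s A powr - \<rho>)"
      by (simp only: \<Phi>_def mult.commute)
  qed
qed


section \<open>Hausdorff dimension and Riesz potentials\<close>

lemma hausdorff_dim_mono:
  assumes "E \<subseteq> F"
  shows "hausdorff_dim E \<le> hausdorff_dim F"
proof -
  have pre: "hausdorff_premeasure s \<delta> E \<le> hausdorff_premeasure s \<delta> F" for s \<delta>
    unfolding hausdorff_premeasure_def using assms by (intro INF_superset_mono) auto
  have "hausdorff_measure s E \<le> hausdorff_measure s F" for s
    unfolding hausdorff_measure_def by (intro SUP_mono) (use pre in auto)
  then show ?thesis
    unfolding hausdorff_dim_def by (intro Inf_superset_mono) (auto, metis le_zero_eq)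
qed

lemma hausdorff_dim_le:
  assumes "0 \<le> s" and "\<And>t. s < t \<Longrightarrow> hausdorff_measure t E = 0"
  shows "hausdorff_dim E \<le> ennreal s"
proof (rule ennreal_le_epsilon)
  fix e :: real assume "0 < e"
  then have "hausdorff_dim E \<le> ennreal (s + e)"
    unfolding hausdorff_dim_def using assms by (intro Inf_lower CollectI exI[of _ "s + e"]) auto
  then show "hausdorff_dim E \<le> ennreal s + ennreal e"
    using assms(1) \<open>0 < e\<close> by simp
qed

lemma hausdorff_measure_eq_0I:
  assumes "\<And>\<delta> \<epsilon>. 0 < \<delta> \<Longrightarrow> 0 < \<epsilon> \<Longrightarrow> \<exists>U :: nat \<Rightarrow> 'a::metric_space set. E \<subseteq> (\<Union>i. U i) \<and>
    (\<forall>i. bounded (U i) \<and> diameter (U i) \<le> \<delta>) \<and> (\<Sum>i. diam_pow t (U i)) \<le> ennreal \<epsilon>"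
  shows "hausdorff_measure t E = 0"
proof -
  have "hausdorff_premeasure t \<delta> E \<le> 0" if "0 < \<delta>" for \<delta>
  proof (rule ennreal_le_epsilon)
    fix e :: real assume "0 < e"
    from assms[OF that this] obtain U where "E \<subseteq> (\<Union>i. U i)"
      "\<forall>i. bounded (U i) \<and> diameter (U i) \<le> \<delta>" "(\<Sum>i. diam_pow t (U i)) \<le> ennreal e" by blast
    then show "hausdorff_premeasure t \<delta> E \<le> 0 + ennreal e"
      unfolding hausdorff_premeasure_def by (intro INF_lower2[of U]) auto
  qed
  then show ?thesis
    unfolding hausdorff_measure_def by (simp add: SUP_eq_iff)
qed

text \<open>
  For covers by sets of diameter at most \<open>1\<close> a larger exponent gives smaller sums.
\<close>

lemma hausdorff_null_cover:
  fixes E :: "'a::metric_space set"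
  assumes "hausdorff_measure t E = 0" "0 \<le> t" "t \<le> s" "0 < s" "0 < \<epsilon>"
  obtains U :: "nat \<Rightarrow> 'a set" where "E \<subseteq> (\<Union>i. U i)" "\<And>i. bounded (U i)"
    "(\<Sum>i. ennreal (diameter (U i) powr s)) < ennreal \<epsilon>"
proof -
  have "hausdorff_premeasure t 1 E \<le> hausdorff_measure t E"
    unfolding hausdorff_measure_def by (intro SUP_upper) auto
  then have "hausdorff_premeasure t 1 E < ennreal \<epsilon>"
    using assms(1,5) by simp
  then obtain U where U: "E \<subseteq> (\<Union>i. U i)" "\<And>i. bounded (U i)" "\<And>i. diameter (U i) \<le> 1"
    "(\<Sum>i. diam_pow t (U i)) < ennreal \<epsilon>"
    unfolding hausdorff_premeasure_def INF_less_iff by auto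
  have "ennreal (diameter (U i) powr s) \<le> diam_pow t (U i)" for i
  proof (cases "U i = {}")
    case False
    have d: "0 \<le> diameter (U i)" by (rule diameter_ge_0[OF U(2)])
    show ?thesis
    proof (cases "diameter (U i) = 0")
      case False
      then have "diameter (U i) powr s \<le> diameter (U i) powr t"
        using d U(3)[of i] assms by (intro powr_mono') auto
      then show ?thesis
        using False \<open>U i \<noteq> {}\<close> by (auto simp: diam_pow_def intro!: ennreal_leI)
    qed simp
  qed (simp add: diam_pow_def)
  then have "(\<Sum>i. ennreal (diameter (U i) powr s)) \<le> (\<Sum>i. diam_pow t (U i))"
    by (intro suminf_le) auto
  then show ?thesis
    using U by (intro that[of U]) auto
qed

text \<open>
  On the ball the kernel is at least \<open>r powr - s\<close>.  For \<open>r = 0\<close> finiteness of the potential excludes an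
  atom at \<open>z\<close>.
\<close>

lemma measure_cball_le_potential:
  fixes \<nu> :: "'a::euclidean_space measure"
  assumes sets: "sets \<nu> = sets borel" and s: "0 < s" and r: "0 \<le> r"
    and M: "(\<integral>\<^sup>+w. riesz_kernel s (z - w) \<partial>\<nu>) \<le> ennreal M" and M0: "0 \<le> M"
  shows "emeasure \<nu> (cball z r) \<le> ennreal (M * r powr s)"
proof (cases "r = 0")
  case True
  have "\<infinity> * emeasure \<nu> {z} = (\<integral>\<^sup>+w. \<infinity> * indicator {z} w \<partial>\<nu>)"
    by (simp add: nn_integral_cmult_indicator sets)
  also have "\<dots> \<le> (\<integral>\<^sup>+w. riesz_kernel s (z - w) \<partial>\<nu>)"
    by (intro nn_integral_mono) (auto simp: riesz_kernel_def indicator_def)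
  finally have "\<infinity> * emeasure \<nu> {z} \<noteq> \<infinity>"
    using M by (auto simp: top_unique)
  then have "emeasure \<nu> {z} = 0"
    by (auto simp: ennreal_mult_eq_top_iff)
  then show ?thesis using True by simp
next
  case False
  then have r: "0 < r" using r by simp
  have "ennreal (r powr - s) * emeasure \<nu> (cball z r) = (\<integral>\<^sup>+w. ennreal (r powr - s) * indicator (cball z r) w \<partial>\<nu>)"
    by (simp add: nn_integral_cmult_indicator sets)
  also have "\<dots> \<le> (\<integral>\<^sup>+w. riesz_kernel s (z - w) \<partial>\<nu>)"
  proof (rule nn_integral_mono)
    fix w
    have "r powr - s \<le> norm (z - w) powr - s" if "norm (z - w) \<le> r" "z \<noteq> w"
      using that s by (intro powr_mono2') auto
    then show "ennreal (r powr - s) * indicator (cball z r) w \<le> riesz_kernel s (z - w)"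
      by (auto simp: riesz_kernel_def indicator_def dist_norm intro!: ennreal_leI)
  qed
  also note M
  finally have "ennreal (r powr s) * (ennreal (r powr - s) * emeasure \<nu> (cball z r)) \<le> ennreal (r powr s) * ennreal M"
    by (rule mult_left_mono) simp
  also have "ennreal (r powr s) * (ennreal (r powr - s) * emeasure \<nu> (cball z r)) = emeasure \<nu> (cball z r)"
    using r by (simp add: mult.assoc[symmetric] ennreal_mult[symmetric] powr_add[symmetric])
  also have "ennreal (r powr s) * ennreal M = ennreal (M * r powr s)"
    using M0 by (simp add: ennreal_mult mult.commute)
  finally show ?thesis .
qed

text \<open>
  The mass distribution principle.  Where the potential is at most \<open>M\<close>, a set of diameter \<open>\<delta>\<close> lies in a
  ball of measure at most \<open>M \<delta>\<^sup>s\<close>.  So if \<open>E\<close> had smaller dimension, its part with potential at most \<open>M\<close>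
  would be null for every \<open>M\<close>, and \<open>E\<close> would be null.
\<close>

lemma hausdorff_dim_ge_of_potential:
  fixes \<nu> :: "'a::euclidean_space measure" and E :: "'a set"
  assumes sets: "sets \<nu> = sets borel" and "sigma_finite_measure \<nu>" and s: "0 < s"
    and pot: "AE z in \<nu>. (\<integral>\<^sup>+w. riesz_kernel s (z - w) \<partial>\<nu>) < \<infinity>"
    and E: "0 < outer_measure_of \<nu> E"
  shows "ennreal s \<le> hausdorff_dim E"
proof -
  interpret sigma_finite_measure \<nu> by fact
  define pt where "pt z = (\<integral>\<^sup>+w. riesz_kernel s (z - w) \<partial>\<nu>)" for z
  have [measurable_cong]: "sets \<nu> = sets borel" by fact
  have pt_meas[measurable]: "pt \<in> borel_measurable borel"
    unfolding pt_def by measurable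
  have "s \<le> t" if t: "0 \<le> t" "hausdorff_measure t E = 0" for t
  proof (rule ccontr)
    assume "\<not> s \<le> t"
    then have ts: "t \<le> s" by simp
    have null: "\<exists>N\<in>null_sets \<nu>. {z\<in>E. pt z \<le> ennreal (real M)} \<subseteq> N" for M :: nat
    proof -
      define L where "L = {z\<in>E. pt z \<le> ennreal (real M)}"
      have "outer_measure_of \<nu> L \<le> 0"
      proof (rule ennreal_le_epsilon)
        fix e :: real assume e: "0 < e"
        define \<epsilon> where "\<epsilon> = e / (real M + 1)"
        have \<epsilon>: "0 < \<epsilon>" using e by (simp add: \<epsilon>_def)
        obtain U where U: "E \<subseteq> (\<Union>i. U i)" "\<And>i. bounded (U i)"
          "(\<Sum>i. ennreal (diameter (U i) powr s)) < ennreal \<epsilon>"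
          using hausdorff_null_cover[OF t(2,1) ts s \<epsilon>] by metis
        \<comment> \<open>Balls are centred at points of \<open>L\<close>, because the potential is controlled only there.\<close>
        define B where "B i = (if U i \<inter> L = {} then {} else cball (SOME z. z \<in> U i \<inter> L) (diameter (U i)))" for i
        have B_le: "emeasure \<nu> (B i) \<le> ennreal (real M) * ennreal (diameter (U i) powr s)" for i
        proof (cases "U i \<inter> L = {}")
          case False
          then have some: "(SOME z. z \<in> U i \<inter> L) \<in> U i \<inter> L" using some_in_eq[of "U i \<inter> L"] by blast
          then show ?thesis
            using False measure_cball_le_potential[OF sets s diameter_ge_0[OF U(2)], of _ "real M" i]
            by (auto simp: B_def L_def pt_def ennreal_mult)
        qed (simp add: B_def)
        have "L \<subseteq> (\<Union>i. B i)"
        proof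
          fix z assume z: "z \<in> L"
          then obtain i where i: "z \<in> U i" using U(1) by (auto simp: L_def)
          then have "(SOME z. z \<in> U i \<inter> L) \<in> U i \<inter> L" using z some_in_eq[of "U i \<inter> L"] by blast
          then have "z \<in> B i"
            using z i diameter_bounded_bound[OF U(2)[of i]] by (auto simp: B_def)
          then show "z \<in> (\<Union>i. B i)" by auto
        qed
        moreover have B_sets: "B i \<in> sets \<nu>" for i by (simp add: B_def sets)
        ultimately have "outer_measure_of \<nu> L \<le> emeasure \<nu> (\<Union>i. B i)"
          unfolding outer_measure_of_def by (intro INF_lower) auto
        also have "\<dots> \<le> (\<Sum>i. emeasure \<nu> (B i))"
          by (rule emeasure_subadditive_countably) (use B_sets in auto)
        also have "\<dots> \<le> (\<Sum>i. ennreal (real M) * ennreal (diameter (U i) powr s))"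
          by (intro suminf_le B_le) auto
        also have "\<dots> = ennreal (real M) * (\<Sum>i. ennreal (diameter (U i) powr s))"
          by simp
        also have "\<dots> \<le> ennreal (real M) * ennreal \<epsilon>"
          using U(3) by (intro mult_left_mono) auto
        also have "\<dots> = ennreal (real M * \<epsilon>)"
          using \<epsilon> by (simp add: ennreal_mult)
        also have "\<dots> \<le> ennreal e"
          using e by (intro ennreal_leI) (simp add: \<epsilon>_def field_simps)
        finally show "outer_measure_of \<nu> L \<le> 0 + ennreal e" by simp
      qed
      moreover obtain N where "N \<in> sets \<nu>" "L \<subseteq> N" "outer_measure_of \<nu> L = emeasure \<nu> N"
        using outer_measure_of_attain[of L \<nu>] by (auto simp: sets sets_eq_imp_space_eq[OF sets])
      ultimately show ?thesis
        unfolding L_def[symmetric] by (auto simp: null_sets_def)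
    qed
    then obtain N where N: "\<And>M. N M \<in> null_sets \<nu>" "\<And>M :: nat. {z\<in>E. pt z \<le> ennreal (real M)} \<subseteq> N M"
      by metis
    from pot obtain N' where N': "N' \<in> null_sets \<nu>" "{z. \<not> pt z < \<infinity>} \<subseteq> N'"
      unfolding pt_def[symmetric] eventually_ae_filter
      by (auto simp: sets_eq_imp_space_eq[OF sets])
    have "E \<subseteq> N' \<union> (\<Union>M. N M)"
    proof
      fix z assume z: "z \<in> E"
      show "z \<in> N' \<union> (\<Union>M. N M)"
      proof (cases "pt z < \<infinity>")
        case True
        then obtain M :: nat where "pt z \<le> of_nat M"
          by (metis ennreal_Ex_less_of_nat infinity_ennreal_def less_imp_le)
        then have "z \<in> N M" using z N(2)[of M] by (auto simp: ennreal_of_nat_eq_real_of_nat)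
        then show ?thesis by auto
      qed (use N' in auto)
    qed
    moreover have "N' \<union> (\<Union>M. N M) \<in> null_sets \<nu>"
      using N(1) N'(1) by auto
    ultimately have "outer_measure_of \<nu> E \<le> 0"
      unfolding outer_measure_of_def by (intro INF_lower2[of "N' \<union> (\<Union>M. N M)"]) auto
    with E show False by simp
  qed
  then show ?thesis
    unfolding hausdorff_dim_def by (intro Inf_greatest) (auto intro!: ennreal_leI)
qed


section \<open>Words and the coding map\<close>

lemma length_prefix_word[simp]: "length (prefix_word x n) = n"
  by (simp add: prefix_word_def)

lemma prefix_word_0[simp]: "prefix_word x 0 = []"
  by (simp add: prefix_word_def)

lemma prefix_word_Suc: "prefix_word x (Suc n) = x 0 # prefix_word (shift x) n"
  by (simp add: prefix_word_def shift_def upt_conv_Cons map_Suc_upt[symmetric] comp_def del: upt_Suc)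

lemma prefix_word_eq_iff: "prefix_word x n = prefix_word y n \<longleftrightarrow> (\<forall>i<n. x i = y i)"
  by (auto simp: prefix_word_def)

lemma prefix_word_conc: "prefix_word (conc w x) (length w) = w"
  by (auto simp: prefix_word_def conc_def intro!: nth_equalityI)

lemma cylinder_eq: "cylinder w = {x. prefix_word x (length w) = w}"
proof safe
  fix x assume "x \<in> cylinder w"
  then show "prefix_word x (length w) = w"
    by (auto simp: cylinder_def prefix_word_conc)
next
  fix x assume w: "prefix_word x (length w) = w"
  have "x = conc w (\<lambda>i. x (i + length w))"
  proof
    fix i
    have "w ! i = x i" if "i < length w"
      using that by (subst w[symmetric]) (simp add: prefix_word_def)
    then show "x i = conc w (\<lambda>i. x (i + length w)) i"
      by (simp add: conc_def)
  qed
  then show "x \<in> cylinder w" by (auto simp: cylinder_def)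
qed

lemma measurable_prefix_word[measurable]: "(\<lambda>x. prefix_word x n) \<in> measurable borel (count_space UNIV)"
proof (induction n)
  case (Suc n)
  have "prefix_word x (Suc n) = prefix_word x n @ [x n]" for x
    by (simp add: prefix_word_def)
  moreover have "(\<lambda>x :: nat \<Rightarrow> nat. x n) \<in> measurable borel (count_space UNIV)"
    using measurable_product_coordinates[of n] measurable_cong_sets[OF refl sets_borel_eq_count_space]
    by blast
  ultimately show ?case
    using Suc by simp
qed simp

lemma sets_cylinder[measurable]: "cylinder w \<in> sets borel"
proof -
  have "cylinder w = (\<lambda>x. prefix_word x (length w)) -` {w} \<inter> space borel"
    by (auto simp: cylinder_eq)
  then show ?thesis
    using measurable_sets[OF measurable_prefix_word] by simp
qed

lemma word_matrix_Nil[simp]: "word_matrix T [] = mat 1"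
  and word_matrix_Cons: "word_matrix T (i # w) = T i ** word_matrix T w"
  by (simp_all add: word_matrix_def)

lemma space_translation_measure:
  "space (translation_measure :: (nat \<Rightarrow> real^'d) measure) = {a. \<forall>i. a i \<in> cbox 0 1}"
  by (auto simp: translation_measure_def space_PiM space_restrict_space)

lemma norm_unit_cube_le:
  fixes x :: "real^'d"
  assumes "x \<in> cbox 0 1"
  shows "norm x \<le> real CARD('d)"
proof -
  have "norm x \<le> (\<Sum>i\<in>UNIV. \<bar>x $ i\<bar>)" by (rule norm_le_l1_cart)
  also have "\<dots> \<le> (\<Sum>i\<in>(UNIV :: 'd set). 1)"
    using assms by (intro sum_mono) (auto simp: mem_box_cart abs_le_iff intro: order_trans[of _ 0])
  finally show ?thesis by simp
qed

text \<open>
  The strict bound on the supremum of the operator norms leaves room for one \<open>\<theta> < 1/2\<close> that serves all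
  letters.
\<close>

locale affine_system =
  fixes T :: "nat \<Rightarrow> real^'d^'d" and \<theta> :: real
  assumes invertible_T: "\<And>i. invertible (T i)"
    and theta: "0 < \<theta>" "\<theta> < 1 / 2"
    and contraction: "\<And>i x. norm (T i *v x) \<le> \<theta> * norm x"
begin

lemma invertible_word: "invertible (word_matrix T w)"
proof (induction w)
  case Nil
  show ?case by (auto simp: invertible_def intro: exI[of _ "mat 1"])
next
  case (Cons i w)
  then show ?case by (simp add: word_matrix_Cons invertible_mult invertible_T)
qed

lemma norm_word_le: "norm (word_matrix T w *v x) \<le> \<theta> ^ length w * norm x"
proof (induction w)
  case (Cons i w)
  have "norm (word_matrix T (i # w) *v x) = norm (T i *v (word_matrix T w *v x))"
    by (simp add: word_matrix_Cons matrix_vector_mul_assoc)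
  also have "\<dots> \<le> \<theta> * norm (word_matrix T w *v x)" by (rule contraction)
  also have "\<dots> \<le> \<theta> * (\<theta> ^ length w * norm x)"
    using theta Cons by (intro mult_left_mono) auto
  finally show ?case by (simp add: mult_ac)
qed simp

lemma potential_pos:
  assumes "0 \<le> s" "s \<le> real CARD('d)"
  shows "0 < sv_potential T s w"
  unfolding sv_potential_def by (rule singular_value_function_pos[OF invertible_word assms])

lemma potential_le:
  assumes "0 \<le> s" "s \<le> real CARD('d)"
  shows "sv_potential T s w \<le> (\<theta> powr s) ^ length w"
proof -
  have "sv_potential T s w \<le> (\<theta> ^ length w) powr s"
    unfolding sv_potential_def
    by (rule singular_value_function_le_powr[OF invertible_word assms norm_word_le])
  also have "\<dots> = (\<theta> powr s) ^ length w"
    using theta by (simp add: powr_realpow[symmetric] powr_powr mult.commute)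
  finally show ?thesis .
qed

text \<open>
  The radius of a ball about the origin that contains all the self-affine sets.
\<close>

definition coding_radius :: real where "coding_radius = real CARD('d) / (1 - \<theta>)"

lemma coding_radius_nonneg: "0 \<le> coding_radius"
  using theta by (simp add: coding_radius_def)

lemma coding_term_le:
  assumes "norm t \<le> real CARD('d)"
  shows "norm (word_matrix T (prefix_word x j) *v t) \<le> \<theta> ^ j * real CARD('d)"
proof -
  have "norm (word_matrix T (prefix_word x j) *v t) \<le> \<theta> ^ j * norm t"
    using norm_word_le[of "prefix_word x j" t] by simp
  also have "\<dots> \<le> \<theta> ^ j * real CARD('d)"
    using assms theta by (intro mult_left_mono) auto
  finally show ?thesis .
qed

lemma summable_theta: "summable (\<lambda>j. \<theta> ^ j * c)"
  using theta by (intro summable_mult2 summable_geometric) auto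

lemma coding_summable:
  assumes "\<And>j. norm (u j) \<le> real CARD('d)"
  shows "summable (\<lambda>j. norm (word_matrix T (prefix_word x j) *v u j))"
    and "summable (\<lambda>j. word_matrix T (prefix_word x j) *v u j)"
proof -
  show 1: "summable (\<lambda>j. norm (word_matrix T (prefix_word x j) *v u j))"
    by (rule summable_comparison_test'[OF summable_theta[of "real CARD('d)"], of 0])
      (simp add: coding_term_le assms)
  then show "summable (\<lambda>j. word_matrix T (prefix_word x j) *v u j)"
    by (rule summable_norm_cancel)
qed

lemma translation_norm_le:
  assumes "a \<in> space translation_measure"
  shows "norm (a i :: real^'d) \<le> real CARD('d)"
  using assms by (intro norm_unit_cube_le) (simp add: space_translation_measure)

lemma coding_map_norm_le:
  assumes a: "a \<in> space translation_measure"
  shows "norm (coding_map T a x) \<le> coding_radius"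
proof -
  have "norm (coding_map T a x) \<le> (\<Sum>j. norm (word_matrix T (prefix_word x j) *v a (x j)))"
    unfolding coding_map_def by (intro summable_norm coding_summable translation_norm_le a)
  also have "\<dots> \<le> (\<Sum>j. \<theta> ^ j * real CARD('d))"
    by (intro suminf_le coding_summable translation_norm_le a coding_term_le summable_theta)
  also have "\<dots> = coding_radius"
    using theta by (subst suminf_mult2[symmetric]) (auto simp: suminf_geometric coding_radius_def)
  finally show ?thesis .
qed

lemma coding_map_step:
  assumes a: "a \<in> space translation_measure"
  shows "coding_map T a x = a (x 0) + T (x 0) *v coding_map T a (shift x)"
proof -
  have "summable (\<lambda>j. word_matrix T (prefix_word x j) *v a (x j))"
    by (intro coding_summable translation_norm_le a)
  from suminf_split_head[OF this] have "coding_map T a x = a (x 0) +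
      (\<Sum>j. word_matrix T (prefix_word x (Suc j)) *v a (x (Suc j)))"
    unfolding coding_map_def by (simp add: algebra_simps)
  also have "(\<Sum>j. word_matrix T (prefix_word x (Suc j)) *v a (x (Suc j)))
      = (\<Sum>j. T (x 0) *v (word_matrix T (prefix_word (shift x) j) *v a (shift x j)))"
    by (simp add: prefix_word_Suc word_matrix_Cons matrix_vector_mul_assoc shift_def)
  also have "\<dots> = T (x 0) *v coding_map T a (shift x)"
    unfolding coding_map_def
    by (intro bounded_linear.suminf[symmetric] matrix_vector_mul_bounded_linear
        coding_summable translation_norm_le a)
  finally show ?thesis by simp
qed

text \<open>
  A common prefix contributes the same terms to both series; what is left factors through its matrix.
\<close>

lemma coding_map_diff:
  assumes a: "a \<in> space translation_measure" and eq: "prefix_word x n = prefix_word y n"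
  shows "coding_map T a x - coding_map T a y = word_matrix T (prefix_word x n) *v
    (coding_map T a (\<lambda>j. x (n + j)) - coding_map T a (\<lambda>j. y (n + j)))"
  using eq
proof (induction n arbitrary: x y)
  case (Suc n)
  then have eq: "x 0 = y 0" "prefix_word (shift x) n = prefix_word (shift y) n"
    by (auto simp: prefix_word_Suc)
  have "coding_map T a x - coding_map T a y
      = T (x 0) *v (coding_map T a (shift x) - coding_map T a (shift y))"
    by (simp add: coding_map_step[OF a, of x] coding_map_step[OF a, of y] eq
        matrix_vector_mult_diff_distrib)
  also have "\<dots> = word_matrix T (prefix_word x (Suc n)) *v
      (coding_map T a (\<lambda>j. x (Suc n + j)) - coding_map T a (\<lambda>j. y (Suc n + j)))"
    unfolding Suc.IH[OF eq(2)]
    by (simp add: prefix_word_Suc word_matrix_Cons matrix_vector_mul_assoc shift_def)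
  finally show ?case .
qed simp


section \<open>Transversality\<close>

text \<open>
  The part of the series for the coding map that involves the translation of letter \<open>i\<close>, evaluated with
  that translation equal to \<open>t\<close>.
\<close>

definition letter_coefficient :: "(nat \<Rightarrow> nat) \<Rightarrow> nat \<Rightarrow> real^'d \<Rightarrow> real^'d" where
  "letter_coefficient x i t = (\<Sum>j. word_matrix T (prefix_word x j) *v (if x j = i then t else 0))"

text \<open>
  Bounds the operator norm of the part of \<open>letter_coefficient x i\<close> that comes from positions after the
  first.
\<close>

definition tail_weight :: "(nat \<Rightarrow> nat) \<Rightarrow> nat \<Rightarrow> real" where
  "tail_weight x i = (\<Sum>j. if x (Suc j) = i then \<theta> ^ Suc j else 0)"

lemma summable_word_action:
  assumes "\<And>j. norm (u j) \<le> B"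
  shows "summable (\<lambda>j. word_matrix T (prefix_word x j) *v u j)"
proof (rule summable_norm_cancel, rule summable_comparison_test'[OF summable_theta[of B], of 0])
  fix j
  have "norm (word_matrix T (prefix_word x j) *v u j) \<le> \<theta> ^ j * norm (u j)"
    using norm_word_le[of "prefix_word x j" "u j"] by simp
  also have "\<dots> \<le> \<theta> ^ j * B"
    using assms theta by (intro mult_left_mono) auto
  finally show "norm (norm (word_matrix T (prefix_word x j) *v u j)) \<le> \<theta> ^ j * B" by simp
qed

lemma letter_summable: "summable (\<lambda>j. word_matrix T (prefix_word x j) *v (if x j = i then t else 0))"
  by (rule summable_word_action[of _ "norm t"]) simp

lemma linear_letter_coefficient: "linear (letter_coefficient x i)"
proof (rule linearI)
  fix t u :: "real^'d" and r :: real
  show "letter_coefficient x i (t + u) = letter_coefficient x i t + letter_coefficient x i u"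
    unfolding letter_coefficient_def suminf_add[OF letter_summable letter_summable]
    by (intro suminf_cong) (simp add: matrix_vector_right_distrib)
  show "letter_coefficient x i (r *\<^sub>R t) = r *\<^sub>R letter_coefficient x i t"
    unfolding letter_coefficient_def suminf_scaleR_right[OF letter_summable]
    by (intro suminf_cong) (simp add: matrix_vector_mult_scaleR)
qed

lemma tail_weight_summable: "summable (\<lambda>j. if x (Suc j) = i then \<theta> ^ Suc j else 0)"
  by (rule summable_comparison_test'[OF summable_theta[of \<theta>], of 0]) (use theta in auto)

lemma letter_coefficient_head:
  "norm (letter_coefficient x i t - (if x 0 = i then t else 0)) \<le> tail_weight x i * norm t"
proof -
  define F where "F j = word_matrix T (prefix_word x j) *v (if x j = i then t else 0)" for j
  have F: "summable F" unfolding F_def by (rule letter_summable)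
  have "letter_coefficient x i t - (if x 0 = i then t else 0) = (\<Sum>j. F (Suc j))"
    unfolding suminf_split_head[OF F] by (simp add: letter_coefficient_def F_def[abs_def])
  moreover have "norm (F (Suc j)) \<le> (if x (Suc j) = i then \<theta> ^ Suc j else 0) * norm t" for j
    using norm_word_le[of "prefix_word x (Suc j)" t] by (simp add: F_def)
  then have "norm (\<Sum>j. F (Suc j)) \<le> (\<Sum>j. (if x (Suc j) = i then \<theta> ^ Suc j else 0) * norm t)"
    by (intro norm_suminf_le summable_mult2 tail_weight_summable)
  moreover have "\<dots> = tail_weight x i * norm t"
    unfolding tail_weight_def by (rule suminf_mult2[symmetric, OF tail_weight_summable])
  ultimately show ?thesis by simp
qed

text \<open>
  Every position carries only one letter, so it is counted for at most one of \<open>i\<close> and \<open>k\<close>.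
\<close>

lemma tail_weight_add_le:
  assumes "i \<noteq> k"
  shows "tail_weight x i + tail_weight x k \<le> \<theta> / (1 - \<theta>)"
proof -
  have "tail_weight x i + tail_weight x k
      = (\<Sum>j. (if x (Suc j) = i then \<theta> ^ Suc j else 0) + (if x (Suc j) = k then \<theta> ^ Suc j else 0))"
    unfolding tail_weight_def by (rule suminf_add[OF tail_weight_summable tail_weight_summable])
  also have "\<dots> \<le> (\<Sum>j. \<theta> ^ j * \<theta>)"
    using assms theta
    by (intro suminf_le summable_add tail_weight_summable summable_theta) auto
  also have "\<dots> = \<theta> / (1 - \<theta>)"
    using theta by (subst suminf_mult2[symmetric]) (auto simp: suminf_geometric)
  finally show ?thesis .
qed

text \<open>
  The coefficient of a translation in the difference of the two series is plus or minus the identity, for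
  the two first letters, perturbed by the tails.  Each single perturbation may have norm up to
  \<open>2 \<theta> / (1 - \<theta>)\<close>, which can exceed \<open>1\<close>.  But the perturbations for the two first letters share this
  total weight, so one of them has norm at most \<open>\<theta> / (1 - \<theta>)\<close>, and that is less than \<open>1\<close>.
\<close>

lemma transversality:
  assumes "x 0 \<noteq> y 0"
  obtains i where
    "\<And>t. (1 - \<theta> / (1 - \<theta>)) * norm t \<le> norm (letter_coefficient x i t - letter_coefficient y i t)"
proof -
  define \<eta> where "\<eta> = \<theta> / (1 - \<theta>)"
  have key: "(1 - \<eta>) * norm t \<le> norm (letter_coefficient x i t - letter_coefficient y i t)"
    if i: "(x 0 = i) \<noteq> (y 0 = i)" and le: "tail_weight x i + tail_weight y i \<le> \<eta>" for i t
  proof -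
    define hx where "hx = (if x 0 = i then t else 0)"
    define hy where "hy = (if y 0 = i then t else 0)"
    have "norm t = norm (hx - hy)" using i by (auto simp: hx_def hy_def)
    also have "\<dots> = norm ((letter_coefficient x i t - letter_coefficient y i t)
        - (letter_coefficient x i t - hx) + (letter_coefficient y i t - hy))"
      by simp
    also have "\<dots> \<le> norm (letter_coefficient x i t - letter_coefficient y i t)
        + norm (letter_coefficient x i t - hx) + norm (letter_coefficient y i t - hy)"
      by (meson add_mono norm_triangle_ineq norm_triangle_ineq4 order_trans order_refl)
    also have "\<dots> \<le> norm (letter_coefficient x i t - letter_coefficient y i t)
        + tail_weight x i * norm t + tail_weight y i * norm t"
      unfolding hx_def hy_def by (intro add_mono letter_coefficient_head order_refl)
    also have "\<dots> \<le> norm (letter_coefficient x i t - letter_coefficient y i t) + \<eta> * norm t"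
      using mult_right_mono[OF le, of "norm t"] by (simp add: algebra_simps)
    finally show ?thesis by (simp add: algebra_simps)
  qed
  have "tail_weight x (x 0) + tail_weight x (y 0) \<le> \<eta>" "tail_weight y (x 0) + tail_weight y (y 0) \<le> \<eta>"
    unfolding \<eta>_def using assms by (auto intro: tail_weight_add_le)
  then have "tail_weight x (x 0) + tail_weight y (x 0) \<le> \<eta> \<or> tail_weight x (y 0) + tail_weight y (y 0) \<le> \<eta>"
    by linarith
  then show ?thesis
  proof
    assume "tail_weight x (x 0) + tail_weight y (x 0) \<le> \<eta>"
    then show ?thesis
      using assms that[of "x 0"] key[of "x 0"] by (auto simp: \<eta>_def)
  next
    assume "tail_weight x (y 0) + tail_weight y (y 0) \<le> \<eta>"
    then show ?thesis
      using assms that[of "y 0"] key[of "y 0"] by (auto simp: \<eta>_def)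
  qed
qed

lemma coding_map_letter_affine:
  fixes i :: nat
  assumes "\<And>j. j \<noteq> i \<Longrightarrow> X j \<in> cbox 0 1"
  shows "\<exists>b. \<forall>t\<in>cbox 0 1. coding_map T (X(i := t)) x - coding_map T (X(i := t)) y
      = b + (letter_coefficient x i t - letter_coefficient y i t)"
proof -
  define rest where "rest z = (\<Sum>j. word_matrix T (prefix_word z j) *v (if z j = i then 0 else X (z j)))" for z
  have sm: "summable (\<lambda>j. word_matrix T (prefix_word z j) *v (if z j = i then 0 else X (z j)))" for z
    by (rule summable_word_action[of _ "real CARD('d)"]) (auto intro: norm_unit_cube_le assms)
  have "coding_map T (X(i := t)) z = rest z + letter_coefficient z i t" for z t
    unfolding coding_map_def rest_def letter_coefficient_def suminf_add[OF sm letter_summable]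
    by (intro suminf_cong) auto
  then show ?thesis
    by (intro exI[of _ "rest x - rest y"]) simp
qed

end


section \<open>Averaging over the translations\<close>

abbreviation unit_cube_measure :: "(real^'d) measure" where
  "unit_cube_measure \<equiv> restrict_space lborel (cbox 0 1)"

lemma prob_space_unit_cube: "prob_space (unit_cube_measure :: (real^'d) measure)"
proof (rule prob_space_restrict_space)
  have 1: "(1 :: real^'d) \<bullet> b = 1" if "b \<in> Basis" for b
    using that by (auto simp: Basis_vec_def inner_axis)
  then have "emeasure lborel (cbox 0 (1 :: real^'d)) = (\<Prod>b\<in>(Basis :: (real^'d) set). ((1 - 0) \<bullet> b))"
    by (subst emeasure_lborel_cbox) auto
  also have "(\<Prod>b\<in>(Basis :: (real^'d) set). ((1 - 0) \<bullet> b)) = 1"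
    using 1 by (intro prod.neutral) simp
  finally show "emeasure lborel (cbox 0 (1 :: real^'d)) = 1" by simp
qed simp

lemma prob_space_translation_measure: "prob_space (translation_measure :: (nat \<Rightarrow> real^'d) measure)"
  unfolding translation_measure_def by (rule prob_space_PiM) (rule prob_space_unit_cube)

lemma measurable_translation_component[measurable]:
  "(\<lambda>a. a i) \<in> borel_measurable (translation_measure :: (nat \<Rightarrow> real^'d) measure)"
proof -
  have "(\<lambda>a. a i) \<in> measurable (translation_measure :: (nat \<Rightarrow> real^'d) measure) unit_cube_measure"
    unfolding translation_measure_def by (rule measurable_component_singleton) simp
  moreover have "(\<lambda>t. t) \<in> measurable unit_cube_measure (borel :: (real^'d) measure)"
    by (rule measurable_restrict_space1) simp
  ultimately show ?thesis
    by (rule measurable_compose)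
qed

text \<open>
  Fubini: integrate over the translation of letter \<open>i\<close> first, with all the others fixed.
\<close>

lemma nn_integral_translation_le_one_letter:
  fixes f :: "(nat \<Rightarrow> real^'d) \<Rightarrow> ennreal"
  assumes f: "f \<in> borel_measurable translation_measure"
    and le: "\<And>X. (\<forall>j. j \<noteq> i \<longrightarrow> X j \<in> cbox 0 1) \<Longrightarrow>
      (\<integral>\<^sup>+t. indicator (cbox 0 1) t * f (X(i := t)) \<partial>lborel) \<le> K"
  shows "(\<integral>\<^sup>+a. f a \<partial>translation_measure) \<le> K"
proof -
  define P where "P = (\<Pi>\<^sub>M j\<in>UNIV - {i}. (unit_cube_measure :: (real^'d) measure))"
  interpret C: prob_space "unit_cube_measure :: (real^'d) measure" by (rule prob_space_unit_cube)
  interpret P: prob_space P unfolding P_def by (rule prob_space_PiM) (rule prob_space_unit_cube)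
  interpret CP: pair_sigma_finite "unit_cube_measure :: (real^'d) measure" P ..
  have ins: "insert i (UNIV - {i}) = UNIV" by auto
  have upd: "(\<lambda>(t, X). X(i := t)) \<in> measurable (unit_cube_measure \<Otimes>\<^sub>M P) (translation_measure :: (nat \<Rightarrow> real^'d) measure)"
    using measurable_add_dim[of i "UNIV - {i}" "\<lambda>_. unit_cube_measure :: (real^'d) measure"]
    unfolding translation_measure_def P_def ins
    by (subst measurable_pair_swap_iff) (simp add: case_prod_beta' comp_def)
  have eq: "distr (unit_cube_measure \<Otimes>\<^sub>M P) translation_measure (\<lambda>(t, X). X(i := t))
      = (translation_measure :: (nat \<Rightarrow> real^'d) measure)"
    using distr_pair_PiM_eq_PiM[of "UNIV - {i}" "\<lambda>_. unit_cube_measure" i, OF prob_space_unit_cube prob_space_unit_cube]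
    unfolding translation_measure_def P_def ins .
  have "(\<integral>\<^sup>+a. f a \<partial>translation_measure)
      = (\<integral>\<^sup>+a. f a \<partial>(distr (unit_cube_measure \<Otimes>\<^sub>M P) translation_measure (\<lambda>(t, X). X(i := t))))"
    by (simp only: eq)
  also have "\<dots> = (\<integral>\<^sup>+tX. f ((snd tX)(i := fst tX)) \<partial>(unit_cube_measure \<Otimes>\<^sub>M P))"
    by (subst nn_integral_distr[OF upd]) (simp_all add: f case_prod_beta')
  also have "\<dots> = (\<integral>\<^sup>+X. (\<integral>\<^sup>+t. f (X(i := t)) \<partial>unit_cube_measure) \<partial>P)"
    using measurable_compose[OF upd f]
    by (subst CP.nn_integral_snd[symmetric]) (simp_all add: case_prod_beta')
  also have "\<dots> \<le> (\<integral>\<^sup>+X. K \<partial>P)"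
  proof (rule nn_integral_mono)
    fix X assume "X \<in> space P"
    then have "\<forall>j. j \<noteq> i \<longrightarrow> X j \<in> cbox 0 1"
      by (auto simp: P_def space_PiM space_restrict_space)
    from le[OF this] show "(\<integral>\<^sup>+t. f (X(i := t)) \<partial>unit_cube_measure) \<le> K"
      by (subst nn_integral_restrict_space) (simp_all add: mult.commute)
  qed
  also have "\<dots> = K" by (simp add: P.emeasure_space_1)
  finally show ?thesis .
qed

text \<open>
  Joint measurability for Fubini: term \<open>j\<close> of the series depends on \<open>x\<close> through its first \<open>j + 1\<close> letters,
  of which there are only countably many values.
\<close>

lemma measurable_coding_map_pair:
  "(\<lambda>(a, x). coding_map T a x) \<in> borel_measurable (translation_measure \<Otimes>\<^sub>M borel)"
proof -
  have "(\<lambda>z. word_matrix T (prefix_word (snd z) j) *v fst z (snd z j))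
      \<in> borel_measurable (translation_measure \<Otimes>\<^sub>M borel)" for j
  proof -
    have lin: "(\<lambda>t. A *v t) \<in> borel_measurable borel" for A :: "real^'d^'d"
      by (intro borel_measurable_continuous_onI linear_continuous_on matrix_vector_mul_bounded_linear)
    \<comment> \<open>For a fixed word the term depends only on one translation vector.\<close>
    have 1: "(\<lambda>z. word_matrix T (take j w) *v fst z (w ! j)) \<in> borel_measurable (translation_measure \<Otimes>\<^sub>M borel)" for w
      by (rule measurable_compose[OF _ lin]) measurable
    have 2: "(\<lambda>z. prefix_word (snd z) (Suc j)) \<in> measurable ((translation_measure :: (nat \<Rightarrow> real^'d) measure) \<Otimes>\<^sub>M borel) (count_space UNIV)"
      by measurable
    have "(\<lambda>z. word_matrix T (take j (prefix_word (snd z) (Suc j))) *v fst z (prefix_word (snd z) (Suc j) ! j))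
      \<in> borel_measurable (translation_measure \<Otimes>\<^sub>M borel)"
      by (rule measurable_compose_countable[OF 1 2])
    moreover have "take j (prefix_word x (Suc j)) = prefix_word x j" "prefix_word x (Suc j) ! j = x j" for x
      by (auto simp: prefix_word_def nth_append)
    ultimately show ?thesis by simp
  qed
  then show ?thesis
    unfolding coding_map_def case_prod_beta' by (rule borel_measurable_suminf)
qed

lemma measurable_coding_map:
  assumes "a \<in> space translation_measure"
  shows "coding_map T a \<in> borel_measurable borel"
  using measurable_compose_Pair1[OF assms measurable_coding_map_pair[of T]] by simp

context affine_system
begin

text \<open>
  Only the longest common prefix of \<open>x\<close> and \<open>y\<close> matters.  The bound is stated as a sum over all common
  prefixes, in which every summand is measurable in \<open>y\<close> and easy to integrate.
\<close>

lemma translation_integral_kernel_le: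
  assumes s: "0 \<le> s" "s \<le> real CARD('d)" and rho: "0 \<le> \<rho>" "\<rho> < 1"
  shows "\<exists>K<\<infinity>. \<forall>x y. x \<noteq> y \<longrightarrow>
    (\<integral>\<^sup>+a. riesz_kernel (\<rho> * s) (coding_map T a x - coding_map T a y) \<partial>translation_measure)
      \<le> K * (\<Sum>n. ennreal (sv_potential T s (prefix_word x n) powr - \<rho>) * indicator (cylinder (prefix_word x n)) y)"
proof -
  define c where "c = 1 - \<theta> / (1 - \<theta>)"
  have c: "0 < c" using theta by (simp add: c_def field_simps)
  have R: "0 \<le> 2 * coding_radius" using coding_radius_nonneg by simp
  show ?thesis
  proof (rule nn_integral_riesz_kernel_affine_le[OF s rho c R])
  fix K assume K: "K < \<infinity>" and K_le:
    "\<And>(A :: real^'d^'d) (D :: real^'d \<Rightarrow> real^'d) b S. invertible A \<Longrightarrow> linear D \<Longrightarrow> (\<And>x. c * norm x \<le> norm (D x)) \<Longrightarrow>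
       (\<And>t. t \<in> S \<Longrightarrow> norm (b + D t) \<le> 2 * coding_radius) \<Longrightarrow>
       (\<integral>\<^sup>+t. indicator S t * riesz_kernel (\<rho> * s) (A *v (b + D t)) \<partial>lborel)
         \<le> K * ennreal (singular_value_function s A powr - \<rho>)"
  show ?thesis
  proof (intro exI[of _ K] conjI K allI impI)
    fix x y :: "nat \<Rightarrow> nat" assume "x \<noteq> y"
    then have ex: "\<exists>n. x n \<noteq> y n" by auto
    define n where "n = (LEAST n. x n \<noteq> y n)"
    have n: "x n \<noteq> y n" unfolding n_def using ex by (rule LeastI_ex)
    have pre: "prefix_word x n = prefix_word y n"
      unfolding prefix_word_eq_iff n_def using not_less_Least by blast
    define x' where "x' j = x (n + j)" for j
    define y' where "y' j = y (n + j)" for j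
    have "x' 0 \<noteq> y' 0" using n by (simp add: x'_def y'_def)
    then obtain i where i: "\<And>t. c * norm t \<le> norm (letter_coefficient x' i t - letter_coefficient y' i t)"
      unfolding c_def by (rule transversality) blast
    define D where "D t = letter_coefficient x' i t - letter_coefficient y' i t" for t
    have linD: "linear D"
      unfolding D_def by (intro linear_compose_sub linear_letter_coefficient)
    define W where "W = word_matrix T (prefix_word x n)"
    have diff: "coding_map T a x - coding_map T a y = W *v (coding_map T a x' - coding_map T a y')"
      if "a \<in> space translation_measure" for a
      unfolding W_def x'_def[abs_def] y'_def[abs_def] by (rule coding_map_diff[OF that pre])
    have bnd: "norm (coding_map T a x' - coding_map T a y') \<le> 2 * coding_radius"
      if "a \<in> space translation_measure" for a
      using norm_triangle_ineq4[of "coding_map T a x'" "coding_map T a y'"]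
        coding_map_norm_le[OF that, of x'] coding_map_norm_le[OF that, of y'] by simp
    have "(\<integral>\<^sup>+a. riesz_kernel (\<rho> * s) (coding_map T a x - coding_map T a y) \<partial>translation_measure)
        \<le> K * ennreal (singular_value_function s W powr - \<rho>)"
    proof (rule nn_integral_translation_le_one_letter[where i = i])
      have m[measurable]: "(\<lambda>a. coding_map T a z) \<in> borel_measurable translation_measure" for z
        using measurable_compose[OF measurable_Pair2' measurable_coding_map_pair[of T], of z] by simp
      show "(\<lambda>a. riesz_kernel (\<rho> * s) (coding_map T a x - coding_map T a y)) \<in> borel_measurable translation_measure"
        by measurable
    next
      fix X :: "nat \<Rightarrow> real^'d" assume X: "\<forall>j. j \<noteq> i \<longrightarrow> X j \<in> cbox 0 1"
      have "\<And>j. j \<noteq> i \<Longrightarrow> X j \<in> cbox 0 1" using X by auto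
      then obtain b where b: "\<And>t. t \<in> cbox 0 1 \<Longrightarrow>
          coding_map T (X(i := t)) x' - coding_map T (X(i := t)) y' = b + D t"
        unfolding D_def using coding_map_letter_affine[of i X x' y'] by auto
      have sp: "X(i := t) \<in> space translation_measure" if "t \<in> cbox 0 1" for t
        using X that by (auto simp: space_translation_measure)
      have "(\<integral>\<^sup>+t. indicator (cbox 0 1) t *
            riesz_kernel (\<rho> * s) (coding_map T (X(i := t)) x - coding_map T (X(i := t)) y) \<partial>lborel)
          = (\<integral>\<^sup>+t. indicator (cbox 0 1) t * riesz_kernel (\<rho> * s) (W *v (b + D t)) \<partial>lborel)"
      proof (rule nn_integral_cong)
        fix t :: "real^'d"
        show "indicator (cbox 0 1) t * riesz_kernel (\<rho> * s) (coding_map T (X(i := t)) x - coding_map T (X(i := t)) y)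
          = indicator (cbox 0 1) t * riesz_kernel (\<rho> * s) (W *v (b + D t))"
        proof (cases "t \<in> cbox 0 1")
          case True
          then show ?thesis by (simp only: diff[OF sp] b)
        qed simp
      qed
      also have "\<dots> \<le> K * ennreal (singular_value_function s W powr - \<rho>)"
      proof (rule K_le[OF _ linD])
        show "invertible W" unfolding W_def by (rule invertible_word)
        show "c * norm z \<le> norm (D z)" for z using i by (simp add: D_def)
        show "norm (b + D t) \<le> 2 * coding_radius" if "t \<in> cbox 0 1" for t
          using bnd[OF sp[OF that]] b[OF that] by simp
      qed
      finally show "(\<integral>\<^sup>+t. indicator (cbox 0 1) t *
            riesz_kernel (\<rho> * s) (coding_map T (X(i := t)) x - coding_map T (X(i := t)) y) \<partial>lborel)
          \<le> K * ennreal (singular_value_function s W powr - \<rho>)" .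
    qed
    also have "ennreal (singular_value_function s W powr - \<rho>)
        = (\<Sum>k\<in>{n}. ennreal (sv_potential T s (prefix_word x k) powr - \<rho>) * indicator (cylinder (prefix_word x k)) y)"
      using pre by (simp add: W_def sv_potential_def cylinder_eq)
    also have "\<dots> \<le> (\<Sum>k. ennreal (sv_potential T s (prefix_word x k) powr - \<rho>) * indicator (cylinder (prefix_word x k)) y)"
      by (rule sum_le_suminf) auto
    finally show "(\<integral>\<^sup>+a. riesz_kernel (\<rho> * s) (coding_map T a x - coding_map T a y) \<partial>translation_measure)
      \<le> K * (\<Sum>n. ennreal (sv_potential T s (prefix_word x n) powr - \<rho>) * indicator (cylinder (prefix_word x n)) y)"
      by (simp add: mult_left_mono)
  qed
  qed
qed

text \<open>
  The averaged potential at \<open>\<pi> a x\<close> is bounded uniformly in \<open>x\<close>: the prefix of length \<open>n\<close> contributes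
  \<open>\<phi>(x|n)\<close> to the power \<open>- \<rho>\<close> times the mass of its cylinder, which is at most a constant times
  \<open>q\<^sup>n\<close> with \<open>q = \<theta> powr (s (1 - \<rho>)) < 1\<close>.
\<close>

lemma AE_potential_finite:
  fixes \<mu> :: "(nat \<Rightarrow> nat) measure"
  assumes "prob_space \<mu>" and sets_mu: "sets \<mu> = sets borel"
    and s: "0 < s" "s \<le> real CARD('d)" and rho: "0 \<le> \<rho>" "\<rho> < 1"
    and mu: "\<And>w. measure \<mu> (cylinder w) \<le> C * sv_potential T s w"
  shows "AE a in translation_measure. AE x in \<mu>.
    (\<integral>\<^sup>+y. riesz_kernel (\<rho> * s) (coding_map T a x - coding_map T a y) \<partial>\<mu>) < \<infinity>"
proof -
  interpret mu: prob_space \<mu> by fact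
  interpret A: prob_space "translation_measure :: (nat \<Rightarrow> real^'d) measure"
    by (rule prob_space_translation_measure)
  interpret A_mu: pair_sigma_finite "translation_measure :: (nat \<Rightarrow> real^'d) measure" \<mu> ..
  have [measurable_cong]: "sets \<mu> = sets borel" by (rule sets_mu)
  have s0: "0 \<le> s" using s by simp
  have C: "0 \<le> C"
    using mu[of "[]"] potential_pos[OF s0 s(2), of "[]"] measure_nonneg[of \<mu> "cylinder []"]
    by (metis dual_order.trans linorder_not_le mult_neg_pos)
  define q where "q = (\<theta> powr s) powr (1 - \<rho>)"
  have th: "0 < \<theta> powr s" "\<theta> powr s < 1"
    using theta s powr_less_mono2[of s \<theta> 1] by auto
  have q: "0 < q" "q < 1"
    using th rho powr_less_mono2[of "1 - \<rho>" "\<theta> powr s" 1] by (auto simp: q_def)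
  define G where "G x y = (\<Sum>n. ennreal (sv_potential T s (prefix_word x n) powr - \<rho>) * indicator (cylinder (prefix_word x n)) y)"
    for x y :: "nat \<Rightarrow> nat"
  have emu: "emeasure \<mu> (cylinder w) \<le> ennreal (C * sv_potential T s w)" for w
    unfolding mu.emeasure_eq_measure by (intro ennreal_leI mu)
  have G_le: "(\<integral>\<^sup>+y. G x y \<partial>\<mu>) \<le> ennreal (C / (1 - q))" for x
  proof -
    have "(\<integral>\<^sup>+y. G x y \<partial>\<mu>) = (\<Sum>n. \<integral>\<^sup>+y. ennreal (sv_potential T s (prefix_word x n) powr - \<rho>) * indicator (cylinder (prefix_word x n)) y \<partial>\<mu>)"
      unfolding G_def by (intro nn_integral_suminf) (simp add: measurable_cong_sets[OF sets_mu refl])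
    also have "\<dots> = (\<Sum>n. ennreal (sv_potential T s (prefix_word x n) powr - \<rho>) * emeasure \<mu> (cylinder (prefix_word x n)))"
      by (intro suminf_cong nn_integral_cmult_indicator) (simp add: sets_mu)
    also have "\<dots> \<le> (\<Sum>n. ennreal (C * q ^ n))"
    proof (intro suminf_le allI)
      fix n
      define p where "p = sv_potential T s (prefix_word x n)"
      have p: "0 < p" "p \<le> (\<theta> powr s) ^ n"
        using potential_pos[OF s0 s(2)] potential_le[OF s0 s(2), of "prefix_word x n"] by (auto simp: p_def)
      have "ennreal (p powr - \<rho>) * emeasure \<mu> (cylinder (prefix_word x n)) \<le> ennreal (p powr - \<rho>) * ennreal (C * p)"
        unfolding p_def by (intro mult_left_mono emu) simp
      also have "\<dots> = ennreal (C * (p powr - \<rho> * p powr 1))"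
        using C p by (simp add: ennreal_mult[symmetric] mult_ac)
      also have "p powr - \<rho> * p powr 1 = p powr (1 - \<rho>)"
        using powr_add[of p "- \<rho>" 1] by simp
      also have "p powr (1 - \<rho>) \<le> ((\<theta> powr s) ^ n) powr (1 - \<rho>)"
        using p rho by (intro powr_mono2) auto
      also have "((\<theta> powr s) ^ n) powr (1 - \<rho>) = q ^ n"
        using th unfolding q_def by (simp add: powr_realpow[symmetric] powr_powr mult_ac)
      finally show "ennreal (sv_potential T s (prefix_word x n) powr - \<rho>) * emeasure \<mu> (cylinder (prefix_word x n)) \<le> ennreal (C * q ^ n)"
        using C by (simp add: p_def ennreal_leI mult_left_mono)
    qed auto
    also have "\<dots> = ennreal (\<Sum>n. C * q ^ n)"
      using C q by (intro suminf_ennreal2 summable_mult summable_geometric) auto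
    also have "(\<Sum>n. C * q ^ n) = C / (1 - q)"
      using q by (subst suminf_mult) (auto simp: suminf_geometric)
    finally show ?thesis .
  qed
  have G_meas: "G x \<in> borel_measurable borel" for x
    unfolding G_def by measurable
  \<comment> \<open>The kernel is infinite on the diagonal, which is negligible because \<open>\<mu>\<close> has no atoms.\<close>
  have null: "AE y in \<mu>. x \<noteq> y" for x
  proof -
    have "emeasure \<mu> {x} \<le> ennreal (C * (\<theta> powr s) ^ n)" for n
    proof -
      have "emeasure \<mu> {x} \<le> emeasure \<mu> (cylinder (prefix_word x n))"
        by (intro emeasure_mono) (auto simp: cylinder_eq sets_mu)
      also have "\<dots> \<le> ennreal (C * sv_potential T s (prefix_word x n))" by (rule emu)
      also have "\<dots> \<le> ennreal (C * (\<theta> powr s) ^ n)"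
        using C potential_le[OF s0 s(2), of "prefix_word x n"] by (intro ennreal_leI mult_left_mono) auto
      finally show ?thesis .
    qed
    moreover have "(\<lambda>n. ennreal (C * (\<theta> powr s) ^ n)) \<longlonglongrightarrow> ennreal (C * 0)"
      using th by (intro tendsto_ennrealI tendsto_mult_left LIMSEQ_power_zero) auto
    ultimately have "emeasure \<mu> {x} \<le> ennreal (C * 0)"
      by (intro LIMSEQ_le_const) auto
    moreover have "{x} = (\<Inter>n. cylinder (prefix_word x n))"
      by (auto simp: cylinder_eq prefix_word_eq_iff fun_eq_iff)
    then have "{x} \<in> sets borel"
      by (simp only:) (intro sets.countable_INT, auto)
    ultimately have "{x} \<in> null_sets \<mu>"
      by (simp add: null_sets_def sets_mu)
    from AE_not_in[OF this] show ?thesis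
      by eventually_elim auto
  qed
  obtain K where K: "K < \<infinity>" and K_le: "\<And>x y. x \<noteq> y \<Longrightarrow>
    (\<integral>\<^sup>+a. riesz_kernel (\<rho> * s) (coding_map T a x - coding_map T a y) \<partial>translation_measure) \<le> K * G x y"
    using translation_integral_kernel_le[OF s0 s(2) rho] unfolding G_def[symmetric] by auto
  define k where "k a x y = riesz_kernel (\<rho> * s) (coding_map T a x - coding_map T a y)" for a x y
  have k_meas: "(\<lambda>(a, x, y). k a x y) \<in> borel_measurable (translation_measure \<Otimes>\<^sub>M (borel \<Otimes>\<^sub>M borel))"
  proof -
    have 1: "(\<lambda>z. coding_map T (fst z) (fst (snd z))) \<in> borel_measurable (translation_measure \<Otimes>\<^sub>M (borel \<Otimes>\<^sub>M borel))"
      by (rule measurable_compose[OF _ measurable_coding_map_pair[of T], of "\<lambda>z. (fst z, fst (snd z))", simplified]) measurable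
    have 2: "(\<lambda>z. coding_map T (fst z) (snd (snd z))) \<in> borel_measurable (translation_measure \<Otimes>\<^sub>M (borel \<Otimes>\<^sub>M borel))"
      by (rule measurable_compose[OF _ measurable_coding_map_pair[of T], of "\<lambda>z. (fst z, snd (snd z))", simplified]) measurable
    show ?thesis
      unfolding k_def case_prod_beta' using 1 2 by measurable
  qed
  have k1: "(\<lambda>(a, y). k a x y) \<in> borel_measurable (translation_measure \<Otimes>\<^sub>M \<mu>)" for x
    using measurable_compose[OF _ k_meas, of "\<lambda>(a, y). (a, x, y)" "translation_measure \<Otimes>\<^sub>M \<mu>"]
    by (simp add: case_prod_beta')
  have k2: "(\<lambda>(a, x). \<integral>\<^sup>+y. k a x y \<partial>\<mu>) \<in> borel_measurable (translation_measure \<Otimes>\<^sub>M \<mu>)"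
  proof -
    have "(\<lambda>(z, y). k (fst z) (snd z) y) \<in> borel_measurable ((translation_measure \<Otimes>\<^sub>M \<mu>) \<Otimes>\<^sub>M \<mu>)"
      using measurable_compose[OF _ k_meas, of "\<lambda>(z, y). (fst z, snd z, y)" "(translation_measure \<Otimes>\<^sub>M \<mu>) \<Otimes>\<^sub>M \<mu>"]
      by (simp add: case_prod_beta')
    from mu.borel_measurable_nn_integral[OF this] show ?thesis
      by (simp add: case_prod_beta')
  qed
  have "(\<integral>\<^sup>+a. (\<integral>\<^sup>+x. (\<integral>\<^sup>+y. k a x y \<partial>\<mu>) \<partial>\<mu>) \<partial>translation_measure)
      = (\<integral>\<^sup>+x. (\<integral>\<^sup>+a. (\<integral>\<^sup>+y. k a x y \<partial>\<mu>) \<partial>translation_measure) \<partial>\<mu>)"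
    by (rule A_mu.Fubini'[OF k2, symmetric])
  also have "\<dots> = (\<integral>\<^sup>+x. (\<integral>\<^sup>+y. (\<integral>\<^sup>+a. k a x y \<partial>translation_measure) \<partial>\<mu>) \<partial>\<mu>)"
    by (intro nn_integral_cong A_mu.Fubini'[symmetric] k1)
  also have "\<dots> \<le> (\<integral>\<^sup>+x. (\<integral>\<^sup>+y. K * G x y \<partial>\<mu>) \<partial>\<mu>)"
  proof (rule nn_integral_mono, rule nn_integral_mono_AE)
    fix x
    show "AE y in \<mu>. (\<integral>\<^sup>+a. k a x y \<partial>translation_measure) \<le> K * G x y"
      using null[of x] by eventually_elim (simp add: k_def K_le)
  qed
  also have "\<dots> = (\<integral>\<^sup>+x. K * (\<integral>\<^sup>+y. G x y \<partial>\<mu>) \<partial>\<mu>)"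
    by (intro nn_integral_cong nn_integral_cmult) (simp add: G_meas measurable_cong_sets[OF sets_mu refl])
  also have "\<dots> \<le> (\<integral>\<^sup>+x. K * ennreal (C / (1 - q)) \<partial>\<mu>)"
    by (intro nn_integral_mono mult_left_mono G_le) simp
  also have "\<dots> = K * ennreal (C / (1 - q))"
    by (simp add: mu.emeasure_space_1)
  also have "\<dots> < \<infinity>" using K by (simp add: ennreal_mult_less_top)
  finally have fin: "(\<integral>\<^sup>+a. (\<integral>\<^sup>+x. (\<integral>\<^sup>+y. k a x y \<partial>\<mu>) \<partial>\<mu>) \<partial>translation_measure) \<noteq> \<infinity>" by simp
  have "AE a in translation_measure. (\<integral>\<^sup>+x. (\<integral>\<^sup>+y. k a x y \<partial>\<mu>) \<partial>\<mu>) \<noteq> \<infinity>"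
    using fin by (intro nn_integral_PInf_AE mu.borel_measurable_nn_integral) (use k2 in \<open>simp_all add: case_prod_beta'\<close>)
  moreover have "AE a in translation_measure. a \<in> space translation_measure" by simp
  ultimately show ?thesis
  proof eventually_elim
    case (elim a)
    have "(\<lambda>x. \<integral>\<^sup>+y. k a x y \<partial>\<mu>) \<in> borel_measurable \<mu>"
      using measurable_compose_Pair1[OF elim(2) k2] by simp
    from nn_integral_PInf_AE[OF this elim(1)] show ?case
      by eventually_elim (simp add: k_def less_top[symmetric])
  qed
qed


section \<open>The upper bound\<close>

text \<open>
  Up to a translation the image of the cylinder lies in the image of a ball under the matrix of \<open>w\<close>.
\<close>

lemma cylinder_image_cover:
  assumes s: "0 \<le> s" "s \<le> real CARD('d)" and a: "a \<in> space translation_measure"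
  obtains Q h where "finite Q" "0 < h" "h \<le> \<theta> ^ length w"
    "real (card Q) * h powr s \<le> (4 * coding_radius + 1) ^ CARD('d) * sv_potential T s w"
    "coding_map T a ` cylinder w \<subseteq> (\<Union>p\<in>Q. cball p (real CARD('d) * h))"
proof -
  define W where "W = word_matrix T w"
  define z where "z = conc w (\<lambda>_. 0)"
  have R: "0 \<le> 2 * coding_radius" using coding_radius_nonneg by simp
  obtain v g e k0 where fr: "singular_frame s W v g e k0"
    using singular_frame_exists[OF invertible_word s] unfolding W_def .
  obtain P where P: "finite P"
    "real (card P) * g k0 powr s \<le> (2 * (2 * coding_radius) + 1) ^ CARD('d) * singular_value_function s W"
    "(*v) W ` cball 0 (2 * coding_radius) \<subseteq> (\<Union>p\<in>P. cball p (real CARD('d) * g k0))"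
    using ball_image_cover[OF fr R] .
  define Q where "Q = (+) (coding_map T a z) ` P"
  show ?thesis
  proof (rule that[of Q "g k0"])
    show "finite Q" using P by (simp add: Q_def)
    show "0 < g k0" using fr by (simp add: singular_frame_def)
    show "g k0 \<le> \<theta> ^ length w"
      using fr by (rule singular_frame_le) (simp add: W_def norm_word_le)
    have "card Q = card P" unfolding Q_def by (rule card_image) simp
    then show "real (card Q) * g k0 powr s \<le> (4 * coding_radius + 1) ^ CARD('d) * sv_potential T s w"
      using P(2) by (simp add: sv_potential_def W_def)
    show "coding_map T a ` cylinder w \<subseteq> (\<Union>p\<in>Q. cball p (real CARD('d) * g k0))"
    proof safe
      fix x assume "x \<in> cylinder w"
      then have xw: "prefix_word x (length w) = w" by (simp add: cylinder_eq)
      define u where "u = coding_map T a (\<lambda>j. x (length w + j)) - coding_map T a (\<lambda>j. z (length w + j))"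
      have "coding_map T a x - coding_map T a z = W *v u"
        unfolding W_def u_def using coding_map_diff[OF a, of x "length w" z] xw
        by (simp add: z_def prefix_word_conc)
      then have eq: "coding_map T a x = coding_map T a z + W *v u" by (simp add: algebra_simps)
      have "norm u \<le> 2 * coding_radius"
        unfolding u_def using norm_triangle_ineq4 coding_map_norm_le[OF a] add_mono
        by (metis (no_types, lifting) mult_2 order_trans)
      then have "W *v u \<in> (*v) W ` cball 0 (2 * coding_radius)" by simp
      then obtain p where p: "p \<in> P" "W *v u \<in> cball p (real CARD('d) * g k0)"
        using P(3) by blast
      then show "coding_map T a x \<in> (\<Union>p\<in>Q. cball p (real CARD('d) * g k0))"
        by (intro UN_I[of "coding_map T a z + p"]) (auto simp: Q_def eq)
    qed
  qed
qed

text \<open>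
  Cover by the pieces of all cylinders of one level \<open>n\<close>.  The sum of the \<open>t\<close>-th powers of their diameters is at
  most \<open>B q\<^sup>n\<close> times the total mass of these disjoint cylinders, where \<open>q = \<theta> powr (t - s) < 1\<close>.
\<close>

lemma hausdorff_dim_self_affine_le:
  fixes \<mu> :: "(nat \<Rightarrow> nat) measure"
  assumes "prob_space \<mu>" and sets_mu: "sets \<mu> = sets borel"
    and s: "0 \<le> s" "s \<le> real CARD('d)"
    and mu: "\<And>w. w \<noteq> [] \<Longrightarrow> sv_potential T s w \<le> C * measure \<mu> (cylinder w)" and C: "0 \<le> C"
    and a: "a \<in> space translation_measure"
  shows "hausdorff_dim (self_affine_set T a) \<le> ennreal s"
proof (rule hausdorff_dim_le[OF s(1)], rule hausdorff_measure_eq_0I)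
  interpret mu: prob_space \<mu> by fact
  fix t \<delta> \<epsilon> :: real assume t: "s < t" and \<delta>: "0 < \<delta>" and \<epsilon>: "0 < \<epsilon>"
  define d where "d = real CARD('d)"
  have d: "0 < d" by (simp add: d_def)
  define B where "B = (2 * d) powr t * (4 * coding_radius + 1) ^ CARD('d) * C"
  have B: "0 \<le> B" unfolding B_def using C coding_radius_nonneg by simp
  define q where "q = \<theta> powr (t - s)"
  have q: "0 < q" "q < 1"
    using theta t powr_less_mono2[of "t - s" \<theta> 1] by (auto simp: q_def)
  have "(\<lambda>n. 2 * d * \<theta> ^ n) \<longlonglongrightarrow> 2 * d * 0"
    using theta by (intro tendsto_mult_left LIMSEQ_power_zero) auto
  then have ev1: "\<forall>\<^sub>F n in sequentially. 2 * d * \<theta> ^ n < \<delta>"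
    using \<delta> by (intro order_tendstoD(2)[of _ "2 * d * 0"]) auto
  have "(\<lambda>n. B * q ^ n) \<longlonglongrightarrow> B * 0"
    using q by (intro tendsto_mult_left LIMSEQ_power_zero) auto
  then have ev2: "\<forall>\<^sub>F n in sequentially. B * q ^ n < \<epsilon>"
    using \<epsilon> by (intro order_tendstoD(2)[of _ "B * 0"]) auto
  have "\<forall>\<^sub>F n in sequentially. 2 * d * \<theta> ^ n < \<delta> \<and> B * q ^ n < \<epsilon> \<and> 0 < n"
    using ev1 ev2 eventually_gt_at_top[of 0] by eventually_elim simp
  then obtain n where n: "2 * d * \<theta> ^ n < \<delta>" "B * q ^ n < \<epsilon>" "0 < n"
    by (auto dest: eventually_happens)
  have "\<exists>Q h. finite Q \<and> 0 < h \<and> h \<le> \<theta> ^ length w \<and>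
    real (card Q) * h powr s \<le> (4 * coding_radius + 1) ^ CARD('d) * sv_potential T s w \<and>
    coding_map T a ` cylinder w \<subseteq> (\<Union>p\<in>Q. cball p (real CARD('d) * h))" for w
    using cylinder_image_cover[OF s a, of w] by metis
  then obtain Q h where Q: "\<And>w. finite (Q w)" and h: "\<And>w. 0 < h w" "\<And>w. h w \<le> \<theta> ^ length w"
    and Qh: "\<And>w. real (card (Q w)) * h w powr s \<le> (4 * coding_radius + 1) ^ CARD('d) * sv_potential T s w"
    and cover: "\<And>w. coding_map T a ` cylinder w \<subseteq> (\<Union>p\<in>Q w. cball p (d * h w))"
    unfolding d_def by metis
  define piece where "piece w k = (if length w = n \<and> k < card (Q w)
      then cball (from_nat_into (Q w) k) (d * h w) else {})" for w k
  \<comment> \<open>The covering sets, indexed by a word and the number of a ball, arranged in one sequence; unused indices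
    get the empty set.\<close>
  define U where "U i = (case prod_decode i of (m, k) \<Rightarrow> piece (list_decode m) k)" for i
  have piece_sum: "(\<Sum>k. diam_pow t (piece w k))
      \<le> ennreal (B * q ^ n) * emeasure \<mu> (if length w = n then cylinder w else {})" for w
  proof (cases "length w = n")
    case True
    have "w \<noteq> []" using True n by auto
    have "(\<Sum>k. diam_pow t (piece w k)) = (\<Sum>k<card (Q w). ennreal ((2 * d * h w) powr t))"
    proof (subst suminf_finite[of "{..<card (Q w)}"])
      show "(\<Sum>k<card (Q w). diam_pow t (piece w k)) = (\<Sum>k<card (Q w). ennreal ((2 * d * h w) powr t))"
      proof (rule sum.cong[OF refl])
        fix k assume "k \<in> {..<card (Q w)}"
        moreover have "\<not> d * h w < 0" using mult_pos_pos[OF d h(1)[of w]] by linarith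
        ultimately show "diam_pow t (piece w k) = ennreal ((2 * d * h w) powr t)"
          using True t s by (simp add: piece_def diam_pow_def mult.assoc)
      qed
    qed (auto simp: piece_def diam_pow_def)
    also have "\<dots> = ennreal (real (card (Q w)) * (2 * d * h w) powr t)"
      by (simp add: ennreal_mult ennreal_of_nat_eq_real_of_nat)
    also have "real (card (Q w)) * (2 * d * h w) powr t
        = (2 * d) powr t * (real (card (Q w)) * h w powr s) * h w powr (t - s)"
      using d h(1)[of w] by (simp add: powr_mult powr_add[symmetric])
    also have "\<dots> \<le> (2 * d) powr t * ((4 * coding_radius + 1) ^ CARD('d) * (C * measure \<mu> (cylinder w))) * q ^ n"
    proof (rule mult_mono, rule mult_left_mono)
      have "real (card (Q w)) * h w powr s \<le> (4 * coding_radius + 1) ^ CARD('d) * sv_potential T s w"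
        by (rule Qh)
      also have "\<dots> \<le> (4 * coding_radius + 1) ^ CARD('d) * (C * measure \<mu> (cylinder w))"
        using coding_radius_nonneg mu[OF \<open>w \<noteq> []\<close>] by (intro mult_left_mono) auto
      finally show "real (card (Q w)) * h w powr s \<le> (4 * coding_radius + 1) ^ CARD('d) * (C * measure \<mu> (cylinder w))" .
      have "h w powr (t - s) \<le> (\<theta> ^ n) powr (t - s)"
        using h[of w] True t by (intro powr_mono2) auto
      also have "\<dots> = q ^ n"
        using theta by (simp add: q_def powr_realpow[symmetric] powr_powr mult_ac)
      finally show "h w powr (t - s) \<le> q ^ n" .
    qed (use coding_radius_nonneg C in auto)
    also have "\<dots> = B * q ^ n * measure \<mu> (cylinder w)"
      by (simp add: B_def mult_ac)
    finally show ?thesis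
      using True B q by (simp add: ennreal_leI mu.emeasure_eq_measure ennreal_mult)
  qed (simp add: piece_def diam_pow_def)
  have "(\<Sum>i. diam_pow t (U i)) = (\<Sum>m. \<Sum>k. diam_pow t (piece (list_decode m) k))"
  proof -
    have "(\<Sum>i. diam_pow t (U i)) = (\<Sum>i. (\<lambda>(m, k). diam_pow t (piece (list_decode m) k)) (prod_decode i))"
      by (intro suminf_cong) (simp add: U_def case_prod_beta')
    also have "\<dots> = (\<Sum>m. \<Sum>k. diam_pow t (piece (list_decode m) k))"
      by (rule suminf_ennreal_2dimen) simp
    finally show ?thesis .
  qed
  also have "\<dots> \<le> (\<Sum>m. ennreal (B * q ^ n) * emeasure \<mu> (if length (list_decode m) = n then cylinder (list_decode m) else {}))"
    by (intro suminf_le piece_sum allI) auto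
  also have "\<dots> = ennreal (B * q ^ n) * (\<Sum>m. emeasure \<mu> (if length (list_decode m) = n then cylinder (list_decode m) else {}))"
    by simp
  also have "(\<Sum>m. emeasure \<mu> (if length (list_decode m) = n then cylinder (list_decode m) else {}))
      = emeasure \<mu> (\<Union>m. if length (list_decode m) = n then cylinder (list_decode m) else {})"
  proof (rule suminf_emeasure)
    show "disjoint_family (\<lambda>m. if length (list_decode m) = n then cylinder (list_decode m) else {})"
      using inj_list_decode[of UNIV] by (auto simp: disjoint_family_on_def cylinder_eq inj_on_def)
  qed (auto simp: sets_mu)
  also have "ennreal (B * q ^ n) * \<dots> \<le> ennreal (B * q ^ n) * 1"
    by (intro mult_left_mono mu.emeasure_le_1) simp
  also have "\<dots> \<le> ennreal \<epsilon>"
    using n(2) by (simp add: ennreal_leI)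
  finally have sum: "(\<Sum>i. diam_pow t (U i)) \<le> ennreal \<epsilon>" .
  have piece_small: "bounded (piece w k) \<and> diameter (piece w k) \<le> \<delta>" for w k
  proof -
    have "2 * (d * h w) \<le> \<delta>" if "length w = n"
    proof -
      have "2 * (d * h w) \<le> 2 * (d * \<theta> ^ n)"
        using h(2)[of w] that d by simp
      with n(1) show ?thesis by simp
    qed
    then show ?thesis
      using \<delta> mult_pos_pos[OF d h(1)[of w]] by (auto simp: piece_def)
  qed
  have "self_affine_set T a \<subseteq> (\<Union>i. U i)"
  proof
    fix y assume "y \<in> self_affine_set T a"
    then obtain x where y: "y = coding_map T a x" by (auto simp: self_affine_set_def)
    define w where "w = prefix_word x n"
    have "x \<in> cylinder w" by (simp add: w_def cylinder_eq)
    then obtain p where p: "p \<in> Q w" "y \<in> cball p (d * h w)"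
      using cover[of w] y by blast
    then obtain k where k: "k < card (Q w)" "p = from_nat_into (Q w) k"
      using Q[of w] bij_betw_from_nat_into_finite[of "Q w"] by (auto simp: bij_betw_def image_iff)
    then have "y \<in> piece w k" using p by (simp add: piece_def w_def)
    then have "y \<in> U (prod_encode (list_encode w, k))" by (simp add: U_def)
    then show "y \<in> (\<Union>i. U i)" by blast
  qed
  with sum piece_small show "\<exists>U. self_affine_set T a \<subseteq> (\<Union>i. U i) \<and>
    (\<forall>i. bounded (U i) \<and> diameter (U i) \<le> \<delta>) \<and> (\<Sum>i. diam_pow t (U i)) \<le> ennreal \<epsilon>"
    by (intro exI[of _ U]) (auto simp: U_def split: prod.split)
qed


section \<open>The lower bound\<close>

text \<open>
  The exceptional set of \<open>a\<close> is chosen before \<open>E\<close>, which may therefore depend on \<open>a\<close> arbitrarily.  The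
  exponents \<open>\<rho> s\<close> with \<open>\<rho> < 1\<close> approach \<open>s\<close> along a sequence, so the exceptional sets remain a
  countable union.
\<close>

lemma AE_hausdorff_dim_ge:
  fixes \<mu> :: "(nat \<Rightarrow> nat) measure"
  assumes "prob_space \<mu>" and sets_mu: "sets \<mu> = sets borel"
    and s: "0 < s" "s \<le> real CARD('d)"
    and mu: "\<And>w. measure \<mu> (cylinder w) \<le> C * sv_potential T s w"
  shows "AE a in translation_measure. \<forall>E. 0 < outer_measure_of (distr \<mu> borel (coding_map T a)) E \<longrightarrow>
    ennreal s \<le> hausdorff_dim E"
proof -
  interpret mu: prob_space \<mu> by fact
  define \<rho> where "\<rho> k = 1 - 1 / real (k + 2)" for k :: nat
  have rho: "0 < \<rho> k" "\<rho> k < 1" for k by (auto simp: \<rho>_def field_simps)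
  have "AE a in translation_measure. \<forall>k. AE x in \<mu>.
    (\<integral>\<^sup>+y. riesz_kernel (\<rho> k * s) (coding_map T a x - coding_map T a y) \<partial>\<mu>) < \<infinity>"
    unfolding AE_all_countable
    using AE_potential_finite[OF assms(1) sets_mu s less_imp_le[OF rho(1)] rho(2) mu] by blast
  moreover have "AE a in translation_measure. a \<in> space (translation_measure :: (nat \<Rightarrow> real^'d) measure)" by simp
  ultimately show ?thesis
  proof eventually_elim
    case (elim a)
    show ?case
    proof (intro allI impI)
      fix E assume E: "0 < outer_measure_of (distr \<mu> borel (coding_map T a)) E"
      define \<nu> where "\<nu> = distr \<mu> borel (coding_map T a)"
      have cm: "coding_map T a \<in> measurable \<mu> borel"
        using measurable_coding_map[OF elim(2)] measurable_cong_sets[OF sets_mu refl] by blast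
      interpret nu: prob_space \<nu> unfolding \<nu>_def by (rule mu.prob_space_distr[OF cm])
      have le: "ennreal (\<rho> k * s) \<le> hausdorff_dim E" for k
      proof (rule hausdorff_dim_ge_of_potential[of \<nu>])
        show "sets \<nu> = sets borel" by (simp add: \<nu>_def)
        show "sigma_finite_measure \<nu>" ..
        show "0 < \<rho> k * s" using rho s by simp
        show "0 < outer_measure_of \<nu> E" using E by (simp add: \<nu>_def)
        have int: "(\<integral>\<^sup>+w. riesz_kernel (\<rho> k * s) (z - w) \<partial>\<nu>)
            = (\<integral>\<^sup>+y. riesz_kernel (\<rho> k * s) (z - coding_map T a y) \<partial>\<mu>)" for z
          unfolding \<nu>_def by (subst nn_integral_distr[OF cm]) simp_all
        have [measurable_cong]: "sets \<nu> = sets borel" by (simp add: \<nu>_def)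
        have "(\<lambda>z. \<integral>\<^sup>+w. riesz_kernel (\<rho> k * s) (z - w) \<partial>\<nu>) \<in> borel_measurable borel"
          by measurable
        then have "{z \<in> space borel. (\<integral>\<^sup>+w. riesz_kernel (\<rho> k * s) (z - w) \<partial>\<nu>) < \<infinity>} \<in> sets borel"
          by measurable
        from AE_distr_iff[OF cm this] have "(AE z in \<nu>. (\<integral>\<^sup>+w. riesz_kernel (\<rho> k * s) (z - w) \<partial>\<nu>) < \<infinity>)
            \<longleftrightarrow> (AE x in \<mu>. (\<integral>\<^sup>+w. riesz_kernel (\<rho> k * s) (coding_map T a x - w) \<partial>\<nu>) < \<infinity>)"
          by (simp only: \<nu>_def)
        also have "\<dots>" unfolding int using elim(1) by blast
        finally show "AE z in \<nu>. (\<integral>\<^sup>+w. riesz_kernel (\<rho> k * s) (z - w) \<partial>\<nu>) < \<infinity>" .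
      qed
      have "(\<lambda>k. ennreal (\<rho> k * s)) \<longlonglongrightarrow> ennreal ((1 - 0) * s)"
        unfolding \<rho>_def
        by (intro tendsto_ennrealI tendsto_mult tendsto_diff tendsto_const
            LIMSEQ_ignore_initial_segment[OF lim_const_over_n])
      then show "ennreal s \<le> hausdorff_dim E"
        using le by (intro LIMSEQ_le_const2[of "\<lambda>k. ennreal (\<rho> k * s)"]) auto
    qed
  qed
qed

end


section \<open>Equality of the dimensions\<close>

theorem theorem4p1:
  fixes T :: "nat \<Rightarrow> real^'d^'d"
    and s0 :: real
    and \<mu> :: "(nat \<Rightarrow> nat) measure"
    and F' :: "(nat \<Rightarrow> real^'d) \<Rightarrow> (real^'d) set"
  assumes "\<And>i. invertible (T i)"
    and "(SUP i. ereal (onorm ((*v) (T i)))) < ereal (1/2)"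
    and "\<And>s. 0 \<le> s \<Longrightarrow> s \<le> real CARD('d) \<Longrightarrow> quasi_multiplicative (sv_potential T s)"
    and "0 \<le> s0" "s0 \<le> real CARD('d)"
    and "pressure (sv_potential T s0) = 0"
    and "gibbs_measure (sv_potential T s0) \<mu>"
    and "lyapunov_exponent \<mu> (sv_potential T s0) > -\<infinity>"
    and "\<And>a. a \<in> space translation_measure \<Longrightarrow> F' a \<subseteq> self_affine_set T a"
    and "\<And>a. a \<in> space translation_measure \<Longrightarrow>
           outer_measure_of (distr \<mu> borel (coding_map T a)) (F' a) > 0"
  shows "AE a in translation_measure. hausdorff_dim (F' a) = hausdorff_dim (self_affine_set T a)"
proof -
  obtain \<theta> where \<theta>: "(SUP i. ereal (onorm ((*v) (T i)))) < ereal \<theta>" "\<theta> < 1 / 2"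
    using ereal_dense2[OF assms(2)] by auto
  have on: "onorm ((*v) (T i)) < \<theta>" for i
  proof -
    have "ereal (onorm ((*v) (T i))) \<le> (SUP i. ereal (onorm ((*v) (T i))))"
      by (rule SUP_upper) simp
    from le_less_trans[OF this \<theta>(1)] show ?thesis by simp
  qed
  interpret affine_system T \<theta>
  proof
    show "invertible (T i)" for i by (rule assms(1))
    show "0 < \<theta>" using onorm_pos_le[OF matrix_vector_mul_bounded_linear[of "T 0"]] on[of 0] by simp
    show "\<theta> < 1 / 2" by fact
    show "norm (T i *v x) \<le> \<theta> * norm x" for i x
      using onorm[OF matrix_vector_mul_bounded_linear[of "T i"], of x]
        mult_right_mono[OF less_imp_le[OF on[of i]] norm_ge_zero[of x]] by simp
  qed
  have prob: "prob_space \<mu>" and sets: "sets \<mu> = sets borel"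
    using assms(7) by (simp_all add: gibbs_measure_def)
  obtain C where C: "1 \<le> C" and gibbs': "\<forall>n\<ge>1. \<forall>w\<in>words n.
        1 / C \<le> measure \<mu> (cylinder w) / (sv_potential T s0 w * exp (- real n * real_of_ereal 0)) \<and>
        measure \<mu> (cylinder w) / (sv_potential T s0 w * exp (- real n * real_of_ereal 0)) \<le> C"
    using assms(7) unfolding gibbs_measure_def assms(6) by blast
  have gibbs: "1 / C \<le> measure \<mu> (cylinder w) / sv_potential T s0 w \<and>
      measure \<mu> (cylinder w) / sv_potential T s0 w \<le> C" if "w \<noteq> []" for w
    using gibbs'[rule_format, of "length w" w] that by (simp add: words_def Suc_le_eq)
  interpret mu: prob_space \<mu> by fact
  have lower: "sv_potential T s0 w \<le> C * measure \<mu> (cylinder w)" if "w \<noteq> []" for w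
    using gibbs[OF that] C potential_pos[OF assms(4,5), of w] by (simp add: field_simps)
  \<comment> \<open>The Gibbs inequality concerns nonempty words; the larger constant includes the empty one, which occurs
    as the common prefix of sequences with different first letters.\<close>
  define C' where "C' = max C (1 / sv_potential T s0 [])"
  have upper: "measure \<mu> (cylinder w) \<le> C' * sv_potential T s0 w" for w
  proof -
    have pos: "0 < sv_potential T s0 w" by (rule potential_pos[OF assms(4,5)])
    have "measure \<mu> (cylinder w) / sv_potential T s0 w \<le> C'"
    proof (cases "w = []")
      case True
      have "measure \<mu> (cylinder w) / sv_potential T s0 w \<le> 1 / sv_potential T s0 w"
        using pos by (intro divide_right_mono) auto
      then show ?thesis using True by (simp add: C'_def)
    next
      case False
      then show ?thesis using gibbs[OF False] unfolding C'_def by linarith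
    qed
    with pos show ?thesis by (simp add: field_simps)
  qed
  have dim_le: "hausdorff_dim (self_affine_set T a) \<le> ennreal s0" if "a \<in> space translation_measure" for a
    using hausdorff_dim_self_affine_le[OF prob sets assms(4,5) lower _ that] C by simp
  have dim_ge: "AE a in translation_measure. ennreal s0 \<le> hausdorff_dim (F' a)"
  proof (cases "s0 = 0")
    case False
    then have "0 < s0" using assms(4) by simp
    have "AE a in translation_measure. a \<in> space (translation_measure :: (nat \<Rightarrow> real^'d) measure)" by simp
    with AE_hausdorff_dim_ge[OF prob sets \<open>0 < s0\<close> assms(5) upper] show ?thesis
      by eventually_elim (use assms(10) in blast)
  qed simp
  have "AE a in translation_measure. a \<in> space (translation_measure :: (nat \<Rightarrow> real^'d) measure)" by simp
  with dim_ge show ?thesis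
  proof eventually_elim
    case (elim a)
    have "hausdorff_dim (F' a) \<le> hausdorff_dim (self_affine_set T a)"
      by (rule hausdorff_dim_mono[OF assms(9)[OF elim(2)]])
    with elim(1) dim_le[OF elim(2)] show ?case by (meson antisym order_trans)
  qed
qed

end
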